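(* Let $\Omega\cong R_1\times\cdots\times R_k$ be a finite commutative ring, where each $R_i$ is a finite local ring, and let $u_i=|U(R_i)|$. When every $R_i$ is not a field (that is, none of the $R_i$ is a field), we have $$b_n(u_1,\ldots,u_k)=a_{n,k}\,u_1\cdots u_k,$$ where $a_{n,k}\in\mathbb{Z}$, $a_{0,k}=1$ and $$a_{n,k}=\sum_{j=1}^{k-1}\binom{k-1}{j}a_{n-1,j}.$$
   Context: All rings are commutative with identity. $U(R)$ is the set of units of $R$. For a ring $R$, $K(R)$ is the clique complex of the zero-divisor graph $\Gamma(R)$, whose vertices are the nonzero zero-divisors of $R$ and in which distinct $a,b$ are adjacent iff $ab=0$. $\tilde H_n$ is reduced simplicial homology with integer coefficients. For $\Omega\cong R_1\times\cdots\times R_k$ with $u_i=|U(R_i)|$, $b_n(u_1,\ldots,u_k)$ denotes the Betti number $\operatorname{rank}\tilde H_n(K(\Omega))$. The case of interest is $n\le k-1$, since $\tilde H_n(K(\Omega))=0$ for $n\ge k$.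
   Formalization: The formula is proved for n ≥ 1 only; a_{0,k}=1 serves just as the start of the recurrence. For n = 0 the claim b_0 = u_1⋯u_k always fails for reduced homology: b_0 = 0 since the zero-divisor graph is connected (e.g. Z/4: K is a point, u_1 = 2). *)

theory Defs
  imports
    "HOL-Algebra.Algebra"
    "HOL-Combinatorics.Permutations"
begin

section \<open>Local rings and the zero-divisor graph\<close>

definition local_ring :: "('a, 'm) ring_scheme \<Rightarrow> bool" where
  "local_ring R \<longleftrightarrow> cring R \<and> (\<exists>!I. maximalideal I R)"

definition nonzero_zero_divisors :: "('a, 'm) ring_scheme \<Rightarrow> 'a set" where
  "nonzero_zero_divisors R =
     {a \<in> carrier R. a \<noteq> \<zero>\<^bsub>R\<^esub> \<and> (\<exists>b \<in> carrier R. b \<noteq> \<zero>\<^bsub>R\<^esub> \<and> a \<otimes>\<^bsub>R\<^esub> b = \<zero>\<^bsub>R\<^esub>)}"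

text \<open>A simple graph is a pair of a vertex set and an adjacency relation on it.\<close>

definition zero_divisor_graph :: "('a, 'm) ring_scheme \<Rightarrow> 'a set \<times> ('a \<times> 'a) set" where
  "zero_divisor_graph R =
     (nonzero_zero_divisors R,
      {(a, b). a \<in> nonzero_zero_divisors R \<and> b \<in> nonzero_zero_divisors R
             \<and> a \<noteq> b \<and> a \<otimes>\<^bsub>R\<^esub> b = \<zero>\<^bsub>R\<^esub>})"

text \<open>The empty clique is included as the face of dimension -1, as is convenient for
  reduced homology.\<close>

definition clique_complex :: "'a set \<times> ('a \<times> 'a) set \<Rightarrow> 'a set set" where
  "clique_complex G =
     {\<sigma>. finite \<sigma> \<and> \<sigma> \<subseteq> fst G \<and> (\<forall>a \<in> \<sigma>. \<forall>b \<in> \<sigma>. a \<noteq> b \<longrightarrow> (a, b) \<in> snd G)}"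

definition zero_divisor_complex :: "('a, 'm) ring_scheme \<Rightarrow> 'a set set" where
  "zero_divisor_complex R = clique_complex (zero_divisor_graph R)"

section \<open>Reduced simplicial homology with integer coefficients\<close>

text \<open>Oriented simplicial chains, without a choice of vertex order: an integer chain is a finitely
  supported function on the ordered simplices (lists of distinct vertices spanning a face) that
  changes by the sign of the permutation when the vertices are permuted. The oriented simplex
  \<open>[v\<^sub>0, \<dots>, v\<^sub>n]\<close> is the function taking the value \<open>sign p\<close> at \<open>permute_list p [v\<^sub>0, \<dots>, v\<^sub>n]\<close>
  and 0 elsewhere. The index \<open>m\<close> is the number of vertices, that is, the dimension plus one;
  \<open>m = 0\<close> gives the augmentation term, spanned by the empty simplex.\<close>

definition simplicial_chains :: "'a set set \<Rightarrow> nat \<Rightarrow> ('a list \<Rightarrow> int) set" where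
  "simplicial_chains K m =
     {c. finite {w. c w \<noteq> 0}
       \<and> (\<forall>w. c w \<noteq> 0 \<longrightarrow> length w = m \<and> distinct w \<and> set w \<in> K)
       \<and> (\<forall>w p. p permutes {..<length w} \<longrightarrow> c (permute_list p w) = sign p * c w)}"

text \<open>On the oriented simplex \<open>[v\<^sub>0, \<dots>, v\<^sub>n]\<close> this is the usual alternating sum of the faces
  \<open>(-1)^i [v\<^sub>0, \<dots>, v\<^sub>i\<^sub>-\<^sub>1, v\<^sub>i\<^sub>+\<^sub>1, \<dots>, v\<^sub>n]\<close>, since moving \<open>v\<^sub>i\<close> to the front contributes \<open>(-1)^i\<close>.
  On 0-chains it is the augmentation (sum of the coefficients).\<close>

definition simplicial_boundary :: "('a list \<Rightarrow> int) \<Rightarrow> 'a list \<Rightarrow> int" where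
  "simplicial_boundary c w = (\<Sum>v | c (v # w) \<noteq> 0. c (v # w))"

definition simplicial_cycles :: "'a set set \<Rightarrow> nat \<Rightarrow> ('a list \<Rightarrow> int) set" where
  "simplicial_cycles K m = {c \<in> simplicial_chains K m. simplicial_boundary c = (\<lambda>w. 0)}"

definition simplicial_boundaries :: "'a set set \<Rightarrow> nat \<Rightarrow> ('a list \<Rightarrow> int) set" where
  "simplicial_boundaries K m = simplicial_boundary ` simplicial_chains K (Suc m)"

definition cycle_group :: "'a set set \<Rightarrow> nat \<Rightarrow> ('a list \<Rightarrow> int) monoid" where
  "cycle_group K m =
     \<lparr>carrier = simplicial_cycles K m, monoid.mult = (\<lambda>c d w. c w + d w), one = (\<lambda>w. 0)\<rparr>"

definition reduced_simplicial_homology :: "nat \<Rightarrow> 'a set set \<Rightarrow> ('a list \<Rightarrow> int) set monoid" where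
  "reduced_simplicial_homology n K = cycle_group K (Suc n) Mod simplicial_boundaries K (Suc n)"

section \<open>Rank and Betti numbers\<close>

definition int_independent :: "('a, 'm) monoid_scheme \<Rightarrow> 'a set \<Rightarrow> bool" where
  "int_independent G S \<longleftrightarrow> finite S \<and> S \<subseteq> carrier G \<and>
     (\<forall>e :: 'a \<Rightarrow> int. finprod G (\<lambda>x. x [^]\<^bsub>G\<^esub> e x) S = \<one>\<^bsub>G\<^esub> \<longrightarrow> (\<forall>x \<in> S. e x = 0))"

text \<open>The rank of a (multiplicatively written) abelian group. It is meaningful only for groups of
  finite rank, such as the homology of finite complexes.\<close>

definition abelian_rank :: "('a, 'm) monoid_scheme \<Rightarrow> nat" where
  "abelian_rank G = Sup {card S | S. int_independent G S}"

definition reduced_betti :: "nat \<Rightarrow> 'a set set \<Rightarrow> nat" where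
  "reduced_betti n K = abelian_rank (reduced_simplicial_homology n K)"

section \<open>The coefficients\<close>

text \<open>The value 1 for \<open>n = 0\<close> only starts the recurrence: it is not the coefficient of the reduced
  Betti number in degree 0, which vanishes when no factor is a field.\<close>

primrec betti_coeff :: "nat \<Rightarrow> nat \<Rightarrow> int" where
  "betti_coeff 0 k = 1"
| "betti_coeff (Suc n) k = (\<Sum>j = 1..k - 1. int ((k - 1) choose j) * betti_coeff n j)"

end

theory Submission
  imports Defs "HOL-Library.Disjoint_Sets"
begin

text \<open>
  Write \<open>\<Omega> = R\<^sub>1 \<times> \<dots> \<times> R\<^sub>k\<close>, and let \<open>K\<close> be its zero-divisor complex. For a clique \<open>\<tau>\<close> let \<open>T(\<tau>)\<close>
  be the set of coordinates at which some vertex of \<open>\<tau>\<close> is a unit. Since no \<open>R\<^sub>j\<close> is a field, \<open>R\<^sub>j\<close>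
  contains a nonzero nonunit \<open>s\<^sub>j\<close> annihilated by all nonunits (\<open>local_ring_socle_element\<close>). The
  element of \<open>\<Omega>\<close> that is \<open>s\<^sub>j\<close> at \<open>j\<close> and zero elsewhere annihilates every vertex that is not a unit
  at \<open>j\<close>, so it can be added to every clique \<open>\<tau>\<close> with \<open>j \<notin> T(\<tau>)\<close>; and as it has no unit coordinate,
  adding it does not change \<open>T\<close>. Hence the cliques with \<open>j \<notin> T(\<tau>)\<close> form a cone, and the cones for
  different \<open>j\<close> are compatible, in the sense that the apex of one can be added inside the
  intersection of the two. The union of all these cones, which consists of the cliques with
  \<open>T(\<tau>) \<noteq> {1, \<dots>, k}\<close>, is therefore acyclic (\<open>union_of_cones_acyclic\<close>).

  The remaining cliques, those with \<open>T(\<tau>) = {1, \<dots>, k}\<close>, are facets: a vertex adjacent to all of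
  \<open>\<tau>\<close> would be annihilated by a unit in every coordinate. Attaching facets of dimension \<open>n\<close> to an
  acyclic complex adds one free generator of \<open>H\<^sub>n\<close> for each of them, so the Betti number is the number
  of these facets (\<open>reduced_betti_eq_card_facets_outside_cones\<close>).

  In such a facet the sets of unit coordinates of the vertices are disjoint and cover \<open>{1, \<dots>, k}\<close>,
  and each vertex vanishes outside its own set. The facet is thus a set partition of \<open>{1, \<dots>, k}\<close>
  into \<open>n + 1\<close> blocks together with a tuple of units \<open>x \<in> U(R\<^sub>1) \<times> \<dots> \<times> U(R\<^sub>k)\<close>, its vertices being the
  restrictions of \<open>x\<close> to the blocks (\<open>bij_betw_unit_blocks\<close>). The coefficient \<open>a\<^sub>n\<^sub>,\<^sub>k\<close> is the Stirling
  number of the second kind \<open>S(k, n + 1)\<close>: its recurrence removes the block that contains a fixed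
  element and sums over the complement of that block (\<open>card_partitions_eq_betti_coeff\<close>).
\<close>

section \<open>Chains as alternating functions on lists\<close>

text \<open>Sign change under adjacent transpositions is equivalent to the sign rule for all permutations, and
  unlike the latter it passes through recursion on lists.\<close>

definition alternating :: "('a list \<Rightarrow> int) \<Rightarrow> bool" where
  "alternating c \<longleftrightarrow> (\<forall>xs a b ys. c (xs @ a # b # ys) = - c (xs @ b # a # ys))"

lemma alternatingD: "alternating c \<Longrightarrow> c (xs @ a # b # ys) = - c (xs @ b # a # ys)"
  unfolding alternating_def by blast

lemma alternating_move:
  assumes "alternating c"
  shows "c (xs @ a # ys @ zs) = (-1) ^ length ys * c (xs @ ys @ a # zs)"
proof (induction ys arbitrary: xs)
  case (Cons y ys)
  have "c (xs @ a # (y # ys) @ zs) = - c ((xs @ [y]) @ a # ys @ zs)"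
    using alternatingD[OF assms, of xs a y "ys @ zs"] by simp
  also have "c ((xs @ [y]) @ a # ys @ zs) = (-1) ^ length ys * c ((xs @ [y]) @ ys @ a # zs)"
    by (rule Cons.IH)
  finally show ?case by simp
qed simp

lemma alternating_exchange:
  assumes "alternating c"
  shows "c (xs @ a # ys @ b # zs) = - c (xs @ b # ys @ a # zs)"
proof -
  have "c (xs @ a # ys @ b # zs) = (-1) ^ length ys * c ((xs @ ys) @ a # b # zs)"
    using alternating_move[OF assms, of xs a ys "b # zs"] by simp
  also have "\<dots> = - ((-1) ^ length ys * c (xs @ ys @ b # a # zs))"
    using alternatingD[OF assms, of "xs @ ys" a b zs] by simp
  also have "\<dots> = - c (xs @ b # ys @ a # zs)"
    using alternating_move[OF assms, of xs b ys "a # zs"] by simp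
  finally show ?thesis .
qed

text \<open>Exchanging two equal entries changes the sign and nothing else.\<close>

lemma alternating_distinct:
  assumes "alternating c" and "c w \<noteq> 0"
  shows "distinct w"
proof (rule ccontr)
  assume "\<not> distinct w"
  then obtain xs a ys zs where w: "w = xs @ [a] @ ys @ [a] @ zs"
    using not_distinct_decomp by blast
  have "x = - x \<Longrightarrow> x = 0" for x :: int
    by simp
  from this[OF alternating_exchange[OF assms(1), of xs a ys a zs]] show False
    using assms(2) w by simp
qed

lemma permute_list_transpose:
  assumes "i < length w" "j < length w"
  shows "permute_list (transpose i j) w = w[i := w ! j, j := w ! i]"
proof (rule nth_equalityI)
  fix p assume "p < length (permute_list (transpose i j) w)"
  then have p: "p < length w" by simp
  then have "permute_list (transpose i j) w ! p = w ! transpose i j p"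
    by (simp add: permute_list_def)
  also have "\<dots> = w[i := w ! j, j := w ! i] ! p"
    using p assms by (cases "p = j"; cases "p = i") (simp_all add: nth_list_update)
  finally show "permute_list (transpose i j) w ! p = w[i := w ! j, j := w ! i] ! p" .
qed simp

lemma alternating_transpose:
  assumes "alternating c" "i < j" "j < length w"
  shows "c (permute_list (transpose i j) w) = - c w"
proof -
  let ?xs = "take i w" and ?ys = "take (j - Suc i) (drop (Suc i) w)" and ?zs = "drop (Suc j) w"
  have d: "drop (Suc i) w = ?ys @ w ! j # ?zs"
    using assms id_take_nth_drop[of "j - Suc i" "drop (Suc i) w"] by simp
  have w: "w = ?xs @ w ! i # ?ys @ w ! j # ?zs"
    using id_take_nth_drop[of i w] assms d by simp
  have l: "i = length ?xs" "j = length ?xs + Suc (length ?ys)"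
    using assms by auto
  have "w[i := w ! j, j := w ! i] = ?xs @ w ! j # ?ys @ w ! i # ?zs"
  proof -
    have "(xs @ a # ys @ b # zs)[length xs := b, length xs + Suc (length ys) := a]
            = xs @ b # ys @ a # zs" for xs a ys b and zs :: "'a list"
      by (simp add: list_update_append)
    from this[of ?xs "w ! i" ?ys "w ! j" ?zs] show ?thesis
      using w l by metis
  qed
  with w alternating_exchange[OF assms(1)] show ?thesis
    using assms by (metis permute_list_transpose order.strict_trans)
qed

lemma alternating_permute_list:
  assumes "alternating c" and "p permutes {..<length w}"
  shows "c (permute_list p w) = sign p * c w"
  using finite_lessThan assms(2)
proof (induction rule: permutes_rev_induct)
  case (swap i j p)
    have ij: "transpose i j permutes {..<length w}"
      using swap by (intro permutes_swap_id) auto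
    have "c (permute_list (transpose i j) u) = - c u" if "length u = length w" for u
      using swap that alternating_transpose[OF assms(1), of i j u]
        alternating_transpose[OF assms(1), of j i u]
      by (cases i j rule: linorder_cases) (auto simp: transpose_commute)
    then have "c (permute_list (p \<circ> transpose i j) w) = - (sign p * c w)"
      using swap by (simp add: permute_list_compose[OF ij])
    also have "\<dots> = sign (p \<circ> transpose i j) * c w"
      using swap permutes_imp_permutation[OF finite_lessThan \<open>p permutes {..<length w}\<close>]
      by (simp add: sign_compose sign_swap_id permutation_swap_id)
    finally show ?case .
qed simp

text \<open>An alternating function vanishes on lists with a repeated entry, and there are only finitely many
  lists of length \<open>m\<close> over a finite vertex set; so distinctness and finite support come for free.\<close>

lemma mem_simplicial_chains_iff:
  assumes "finite (\<Union> K)"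
  shows "c \<in> simplicial_chains K m \<longleftrightarrow>
    alternating c \<and> (\<forall>w. c w \<noteq> 0 \<longrightarrow> length w = m \<and> set w \<in> K)"
proof
  assume "c \<in> simplicial_chains K m"
  then have supp: "\<forall>w. c w \<noteq> 0 \<longrightarrow> length w = m \<and> distinct w \<and> set w \<in> K"
    and perm: "\<And>w p. p permutes {..<length w} \<Longrightarrow> c (permute_list p w) = sign p * c w"
    unfolding simplicial_chains_def by blast+
  have "c (xs @ a # b # ys) = - c (xs @ b # a # ys)" for xs a b ys
  proof -
    let ?w = "xs @ b # a # ys" and ?p = "transpose (length xs) (Suc (length xs))"
    have "permute_list ?p ?w = xs @ a # b # ys"
      by (simp add: permute_list_transpose list_update_append nth_append)
    moreover have "?p permutes {..<length ?w}"
      by (intro permutes_swap_id) auto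
    ultimately have "c (xs @ a # b # ys) = sign ?p * c ?w"
      using perm by metis
    then show ?thesis by (simp add: sign_swap_id)
  qed
  then have "alternating c"
    unfolding alternating_def by blast
  then show "alternating c \<and> (\<forall>w. c w \<noteq> 0 \<longrightarrow> length w = m \<and> set w \<in> K)"
    using supp by blast
next
  assume c: "alternating c \<and> (\<forall>w. c w \<noteq> 0 \<longrightarrow> length w = m \<and> set w \<in> K)"
  then have "{w. c w \<noteq> 0} \<subseteq> {w. set w \<subseteq> \<Union> K \<and> length w = m}"
    by auto
  then have "finite {w. c w \<noteq> 0}"
    using finite_lists_length_eq[OF assms] finite_subset by blast
  then show "c \<in> simplicial_chains K m"
    using c alternating_permute_list alternating_distinct
    unfolding simplicial_chains_def by blast
qed

text \<open>A summation range that does not depend on the chain makes the boundary visibly linear.\<close>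

lemma simplicial_boundary_eq_sum:
  assumes "finite V" and "\<And>w. c w \<noteq> 0 \<Longrightarrow> set w \<subseteq> V"
  shows "simplicial_boundary c = (\<lambda>w. \<Sum>v\<in>V. c (v # w))"
proof
  fix w
  have "{v. c (v # w) \<noteq> 0} \<subseteq> V"
    using assms(2) by force
  then show "simplicial_boundary c w = (\<Sum>v\<in>V. c (v # w))"
    unfolding simplicial_boundary_def
    using assms(1) by (intro sum.mono_neutral_left) auto
qed

lemma alternating_sum_Cons:
  assumes "alternating c"
  shows "alternating (\<lambda>w. \<Sum>v\<in>V. c (v # w))"
  unfolding alternating_def
proof (intro allI)
  fix xs a b ys
  have "c (v # xs @ a # b # ys) = - c (v # xs @ b # a # ys)" for v
    using alternatingD[OF assms, of "v # xs" a b ys] by simp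
  then show "(\<Sum>v\<in>V. c (v # xs @ a # b # ys)) = - (\<Sum>v\<in>V. c (v # xs @ b # a # ys))"
    unfolding sum_negf[symmetric] by (intro sum.cong refl)
qed

text \<open>The double sum is antisymmetric in the two new vertices; this is why the boundary of a boundary
  vanishes.\<close>

lemma sum_Cons_Cons_eq_0:
  assumes "alternating c"
  shows "(\<Sum>u\<in>V. \<Sum>v\<in>V. c (v # u # w)) = 0"
proof -
  let ?s = "\<Sum>u\<in>V. \<Sum>v\<in>V. c (v # u # w)"
  have "?s = (\<Sum>v\<in>V. \<Sum>u\<in>V. c (v # u # w))"
    by (rule sum.swap)
  also have "\<dots> = (\<Sum>v\<in>V. \<Sum>u\<in>V. - c (u # v # w))"
    by (intro sum.cong refl alternatingD[OF assms, of "[]", unfolded append_Nil])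
  also have "\<dots> = - ?s"
    by (simp add: sum_negf)
  finally show ?thesis by simp
qed

lemma simplicial_boundary_boundary:
  assumes "finite (\<Union> K)" and c: "c \<in> simplicial_chains K m"
  shows "simplicial_boundary (simplicial_boundary c) = (\<lambda>w. 0)"
proof -
  let ?V = "\<Union> K"
  have alt: "alternating c" and supp: "\<And>w. c w \<noteq> 0 \<Longrightarrow> set w \<subseteq> ?V"
    using c unfolding mem_simplicial_chains_iff[OF assms(1)] by blast+
  have eq: "simplicial_boundary c = (\<lambda>w. \<Sum>v\<in>?V. c (v # w))"
    using simplicial_boundary_eq_sum[OF assms(1) supp] .
  have "set w \<subseteq> ?V" if "simplicial_boundary c w \<noteq> 0" for w
  proof -
    have "\<exists>v\<in>?V. c (v # w) \<noteq> 0"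
      using that sum.neutral[of ?V "\<lambda>v. c (v # w)"] unfolding eq by blast
    then obtain v where "c (v # w) \<noteq> 0"
      by blast
    then show ?thesis using supp[of "v # w"] by simp
  qed
  from simplicial_boundary_eq_sum[OF assms(1) this]
  have "simplicial_boundary (simplicial_boundary c) = (\<lambda>w. \<Sum>u\<in>?V. \<Sum>v\<in>?V. c (v # u # w))"
    unfolding eq by simp
  then show ?thesis
    by (simp add: sum_Cons_Cons_eq_0[OF alt])
qed

section \<open>The cone operator\<close>

text \<open>On chains this is the operator that puts the vertex \<open>v\<close> in front of an oriented simplex (and
  kills the simplices through \<open>v\<close>). As a function on lists it is the alternating sum, over all
  positions of \<open>v\<close> in the list, of the value at the list with that entry deleted. Summing over all
  occurrences, not only the first, makes the result alternate and turns the homotopy formula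
  below into a reading of the recursion equation.\<close>

primrec cone_chain :: "'a \<Rightarrow> ('a list \<Rightarrow> int) \<Rightarrow> 'a list \<Rightarrow> int" where
  "cone_chain v c [] = 0"
| "cone_chain v c (x # w) = (if x = v then c w else 0) - cone_chain v (\<lambda>u. c (x # u)) w"

lemma cone_chain_uminus: "cone_chain v (\<lambda>u. - c u) w = - cone_chain v c w"
  by (induction w arbitrary: c) auto

lemma cone_chain_sum: "cone_chain v (\<lambda>u. \<Sum>x\<in>V. c x u) w = (\<Sum>x\<in>V. cone_chain v (c x) w)"
proof (induction w arbitrary: c)
  case (Cons y w)
  have "cone_chain v (\<lambda>u. \<Sum>x\<in>V. c x (y # u)) w = (\<Sum>x\<in>V. cone_chain v (\<lambda>u. c x (y # u)) w)"
    by (rule Cons.IH)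
  then show ?case
    by (simp add: sum_subtractf)
qed simp

lemma cone_chain_support:
  assumes "cone_chain v c w \<noteq> 0"
  obtains xs ys where "w = xs @ v # ys" "c (xs @ ys) \<noteq> 0"
  using assms
proof (induction w arbitrary: c thesis)
  case (Cons x w)
  consider "x = v" "c w \<noteq> 0" | "cone_chain v (\<lambda>u. c (x # u)) w \<noteq> 0"
    using Cons.prems(2) by (cases "cone_chain v (\<lambda>u. c (x # u)) w = 0") (auto split: if_splits)
  then show ?case
  proof cases
    case 1
    then show ?thesis using Cons.prems(1)[of "[]" w] by simp
  next
    case 2
    show ?thesis
    proof (rule Cons.IH[OF _ 2])
      fix xs ys assume "w = xs @ v # ys" "c (x # xs @ ys) \<noteq> 0"
      then show thesis using Cons.prems(1)[of "x # xs" ys] by simp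
    qed
  qed
qed simp

lemma alternating_Cons: "alternating c \<Longrightarrow> alternating (\<lambda>u. c (x # u))"
  using alternatingD[of c "x # _"] unfolding alternating_def append_Cons by blast

lemma alternating_cone_chain:
  assumes "alternating c"
  shows "alternating (cone_chain v c)"
proof -
  have "cone_chain v c (xs @ a # b # ys) = - cone_chain v c (xs @ b # a # ys)" for xs a b ys
    using assms
  proof (induction xs arbitrary: c)
    case Nil
    have "(\<lambda>u. c (a # b # u)) = (\<lambda>u. - c (b # a # u))"
      using alternatingD[OF Nil, of "[]" a b] by (simp only: append_Nil)
    then have "cone_chain v (\<lambda>u. c (a # b # u)) ys = - cone_chain v (\<lambda>u. c (b # a # u)) ys"
      by (simp only: cone_chain_uminus)
    then show ?case by simp
  next
    case (Cons x xs)
    have 1: "c (xs @ a # b # ys) = - c (xs @ b # a # ys)"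
      by (rule alternatingD[OF Cons.prems])
    have 2: "cone_chain v (\<lambda>u. c (x # u)) (xs @ a # b # ys)
        = - cone_chain v (\<lambda>u. c (x # u)) (xs @ b # a # ys)"
      by (rule Cons.IH[OF alternating_Cons[OF Cons.prems]])
    show ?case unfolding append_Cons cone_chain.simps 1 2 by simp
  qed
  then show ?thesis unfolding alternating_def by blast
qed

text \<open>The recursion equation of the cone operator, summed over the first entry, is the homotopy formula
  \<open>\<partial> C\<^sub>v + C\<^sub>v \<partial> = id\<close>.\<close>

lemma sum_cone_chain:
  assumes "finite V" "v \<in> V"
  shows "(\<Sum>x\<in>V. cone_chain v c (x # w)) = c w - cone_chain v (\<lambda>w. \<Sum>x\<in>V. c (x # w)) w"
  using assms by (simp add: sum_subtractf cone_chain_sum)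

lemma simplicial_boundary_cone_chain:
  assumes "finite V" "v \<in> V" and supp: "\<And>w. c w \<noteq> 0 \<Longrightarrow> set w \<subseteq> V"
  shows "simplicial_boundary (cone_chain v c) w = c w - cone_chain v (simplicial_boundary c) w"
proof -
  have "set w \<subseteq> V" if nz: "cone_chain v c w \<noteq> 0" for w
  proof -
    obtain xs ys where "w = xs @ v # ys" "c (xs @ ys) \<noteq> 0"
      using cone_chain_support[OF nz] .
    then show ?thesis using supp[of "xs @ ys"] assms(2) by simp
  qed
  then have "simplicial_boundary (cone_chain v c) = (\<lambda>w. \<Sum>x\<in>V. cone_chain v c (x # w))"
    by (rule simplicial_boundary_eq_sum[OF assms(1)])
  moreover have "simplicial_boundary c = (\<lambda>w. \<Sum>x\<in>V. c (x # w))"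
    by (rule simplicial_boundary_eq_sum[OF assms(1) supp])
  ultimately show ?thesis
    by (simp only: sum_cone_chain[OF assms(1,2)])
qed

lemma alternating_add:
  assumes "alternating c" "alternating d"
  shows "alternating (\<lambda>w. c w + d w)"
  unfolding alternating_def
proof (intro allI)
  fix xs a b ys
  show "c (xs @ a # b # ys) + d (xs @ a # b # ys) = - (c (xs @ b # a # ys) + d (xs @ b # a # ys))"
    unfolding alternatingD[OF assms(1), of xs a b] alternatingD[OF assms(2), of xs a b] by simp
qed

text \<open>Restricting to a set of simplices keeps alternation because the set of entries ignores order.\<close>

lemma alternating_restrict:
  fixes c :: "'a list \<Rightarrow> int"
  assumes "alternating c"
  shows "alternating (\<lambda>w. if set w \<in> L then c w else 0)"
  unfolding alternating_def
proof (intro allI)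
  fix xs ys :: "'a list" and a b
  have "set (xs @ a # b # ys) = set (xs @ b # a # ys)" by auto
  then show "(if set (xs @ a # b # ys) \<in> L then c (xs @ a # b # ys) else 0)
      = - (if set (xs @ b # a # ys) \<in> L then c (xs @ b # a # ys) else 0)"
    unfolding alternatingD[OF assms, of xs a b] by simp
qed

lemma simplicial_boundary_add:
  assumes "finite V" "\<And>w. c w \<noteq> 0 \<Longrightarrow> set w \<subseteq> V" "\<And>w. d w \<noteq> 0 \<Longrightarrow> set w \<subseteq> V"
  shows "simplicial_boundary (\<lambda>w. c w + d w) w = simplicial_boundary c w + simplicial_boundary d w"
proof -
  have "set w \<subseteq> V" if "c w + d w \<noteq> 0" for w
    using that assms(2,3)[of w] by (cases "c w = 0") auto
  then have "simplicial_boundary (\<lambda>w. c w + d w) = (\<lambda>w. \<Sum>v\<in>V. c (v # w) + d (v # w))"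
    by (rule simplicial_boundary_eq_sum[OF assms(1)])
  moreover have "simplicial_boundary c = (\<lambda>w. \<Sum>v\<in>V. c (v # w))"
    by (rule simplicial_boundary_eq_sum[OF assms(1,2)])
  moreover have "simplicial_boundary d = (\<lambda>w. \<Sum>v\<in>V. d (v # w))"
    by (rule simplicial_boundary_eq_sum[OF assms(1,3)])
  ultimately show ?thesis
    by (simp only: sum.distrib)
qed

lemma simplicial_boundary_uminus: "simplicial_boundary (\<lambda>w. - c w) w = - simplicial_boundary c w"
  by (simp add: simplicial_boundary_def sum_negf)

lemma simplicial_boundary_mem_chains:
  assumes fin: "finite (\<Union> K)" and down: "\<And>\<sigma> \<tau>. \<tau> \<in> K \<Longrightarrow> \<sigma> \<subseteq> \<tau> \<Longrightarrow> \<sigma> \<in> K"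
    and c: "c \<in> simplicial_chains K (Suc m)"
  shows "simplicial_boundary c \<in> simplicial_chains K m"
proof -
  have alt: "alternating c" and supp: "\<And>w. c w \<noteq> 0 \<Longrightarrow> length w = Suc m \<and> set w \<in> K"
    using c unfolding mem_simplicial_chains_iff[OF fin] by blast+
  have eq: "simplicial_boundary c = (\<lambda>w. \<Sum>v\<in>\<Union> K. c (v # w))"
    by (rule simplicial_boundary_eq_sum[OF fin]) (use supp in blast)
  have "length w = m \<and> set w \<in> K" if "simplicial_boundary c w \<noteq> 0" for w
  proof -
    have "\<exists>v\<in>\<Union> K. c (v # w) \<noteq> 0"
      using that sum.neutral[of "\<Union> K" "\<lambda>v. c (v # w)"] unfolding eq by blast
    then obtain v where "length (v # w) = Suc m" "set (v # w) \<in> K"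
      using supp by blast
    then show ?thesis using down[of "set (v # w)" "set w"] by auto
  qed
  moreover have "alternating (simplicial_boundary c)"
    unfolding eq by (rule alternating_sum_Cons[OF alt])
  ultimately show ?thesis
    unfolding mem_simplicial_chains_iff[OF fin] by blast
qed

lemma simplicial_chains_add:
  assumes "finite (\<Union> K)" "c \<in> simplicial_chains K m" "d \<in> simplicial_chains K m"
  shows "(\<lambda>w. c w + d w) \<in> simplicial_chains K m"
proof -
  have "c w \<noteq> 0 \<or> d w \<noteq> 0" if "c w + d w \<noteq> 0" for w
    using that by auto
  then show ?thesis
    using assms(2,3) alternating_add[of c d] unfolding mem_simplicial_chains_iff[OF assms(1)] by blast
qed

lemma simplicial_chains_mono:
  assumes "finite (\<Union> K)" "L \<subseteq> K"
  shows "simplicial_chains L m \<subseteq> simplicial_chains K m"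
  using assms unfolding simplicial_chains_def by blast

section \<open>Unions of compatible cones\<close>

text \<open>Induction on the number of cones. A cycle \<open>z\<close> is split as \<open>z\<^sub>1 + z\<^sub>2\<close>, with \<open>z\<^sub>2\<close> carried by the
  simplices of the last cone \<open>S i\<close> that lie in no other cone. Since \<open>\<partial> z\<^sub>2 = - \<partial> z\<^sub>1\<close>, the chain \<open>\<partial> z\<^sub>2\<close>
  lives in the intersection of \<open>S i\<close> with the other cones, and coning it off from the apex of \<open>S i\<close>
  stays in the other cones. So subtracting the boundary of the cone over \<open>z\<^sub>2\<close> pushes \<open>z\<close> into the
  union of the other cones.\<close>

theorem union_of_cones_acyclic:
  fixes S :: "'i \<Rightarrow> 'a set set"
  assumes fin: "finite J" "finite V"
    and sub: "\<And>j. j \<in> J \<Longrightarrow> S j \<subseteq> Pow V"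
    and down: "\<And>j \<sigma> \<tau>. j \<in> J \<Longrightarrow> \<tau> \<in> S j \<Longrightarrow> \<sigma> \<subseteq> \<tau> \<Longrightarrow> \<sigma> \<in> S j"
    and apex: "\<And>j. j \<in> J \<Longrightarrow> p j \<in> V"
    and cone: "\<And>i j \<tau>. i \<in> J \<Longrightarrow> j \<in> J \<Longrightarrow> \<tau> \<in> S i \<Longrightarrow> \<tau> \<in> S j \<Longrightarrow> insert (p j) \<tau> \<in> S i"
  shows "z \<in> simplicial_cycles (\<Union>j\<in>J. S j) m \<Longrightarrow>
    \<exists>y\<in>simplicial_chains (\<Union>j\<in>J. S j) (Suc m). simplicial_boundary y = z"
  using fin(1) sub down apex cone
proof (induction J arbitrary: z rule: finite_induct)
  case empty
  then have "z = (\<lambda>w. 0)"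
    by (auto simp: simplicial_cycles_def simplicial_chains_def)
  moreover have "(\<lambda>w. 0) \<in> simplicial_chains {} (Suc m)"
    by (simp add: simplicial_chains_def)
  moreover have "simplicial_boundary (\<lambda>w. 0) = (\<lambda>w::'a list. 0)"
    by (simp add: simplicial_boundary_def fun_eq_iff)
  ultimately show ?case by auto
next
  case (insert i J)
  let ?L = "\<Union>j\<in>J. S j" and ?K = "\<Union>j\<in>insert i J. S j"
  have KV: "\<Union> ?K \<subseteq> V" and LV: "\<Union> ?L \<subseteq> V"
    using insert.prems(2) by blast+
  from this[THEN finite_subset, OF fin(2)]
  have finK: "finite (\<Union> ?K)" and finL: "finite (\<Union> ?L)" .
  have L_down: "\<sigma> \<in> ?L" if "\<tau> \<in> ?L" "\<sigma> \<subseteq> \<tau>" for \<sigma> \<tau>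
    using that insert.prems(3) by blast
  have K_down: "\<sigma> \<in> ?K" if "\<tau> \<in> ?K" "\<sigma> \<subseteq> \<tau>" for \<sigma> \<tau>
    using that insert.prems(3) by blast
  have S_down: "\<sigma> \<in> S i" if "\<tau> \<in> S i" "\<sigma> \<subseteq> \<tau>" for \<sigma> \<tau>
    using that insert.prems(3) by blast
  have z: "z \<in> simplicial_chains ?K m" and dz: "simplicial_boundary z = (\<lambda>w. 0)"
    using insert.prems(1) by (simp_all add: simplicial_cycles_def)
  have alt: "alternating z" and z_supp: "\<And>w. z w \<noteq> 0 \<Longrightarrow> length w = m \<and> set w \<in> ?K"
    using z unfolding mem_simplicial_chains_iff[OF finK] by blast+
  define z1 where "z1 = (\<lambda>w. if set w \<in> ?L then z w else 0)"
  define z2 where "z2 = (\<lambda>w. if set w \<in> - ?L then z w else 0)"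
  have alt1: "alternating z1" and alt2: "alternating z2"
    unfolding z1_def z2_def by (rule alternating_restrict[OF alt])+
  have supp1: "length w = m \<and> set w \<in> ?L" if "z1 w \<noteq> 0" for w
    using that z_supp[of w] by (auto simp: z1_def split: if_splits)
  have supp2: "length w = m \<and> set w \<in> S i" if "z2 w \<noteq> 0" for w
    using that z_supp[of w] by (auto simp: z2_def split: if_splits)
  have V1: "set w \<subseteq> V" if "z1 w \<noteq> 0" for w
    using supp1[OF that] LV by blast
  have V2: "set w \<subseteq> V" if "z2 w \<noteq> 0" for w
    using supp2[OF that] KV by blast
  have z_eq: "z = (\<lambda>w. z1 w + z2 w)"
    by (auto simp: z1_def z2_def)
  have dz2: "simplicial_boundary z2 w = - simplicial_boundary z1 w" for w
    using simplicial_boundary_add[where c = z1 and d = z2 and w = w, OF fin(2) V1 V2] dz[unfolded z_eq] by (simp add: fun_eq_iff)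
  have eq1: "simplicial_boundary z1 = (\<lambda>w. \<Sum>v\<in>V. z1 (v # w))"
    by (rule simplicial_boundary_eq_sum[OF fin(2) V1])
  have eq2: "simplicial_boundary z2 = (\<lambda>w. \<Sum>v\<in>V. z2 (v # w))"
    by (rule simplicial_boundary_eq_sum[OF fin(2) V2])
  have supp_d: "Suc (length w) = m \<and> set w \<in> S i \<and> set w \<in> ?L"
    if nz: "simplicial_boundary z2 w \<noteq> 0" for w
  proof -
    have "\<exists>v\<in>V. z2 (v # w) \<noteq> 0"
      using nz sum.neutral[of V "\<lambda>v. z2 (v # w)"] unfolding eq2 by blast
    then obtain v where v: "length (v # w) = m" "set (v # w) \<in> S i"
      using supp2 by blast
    have "simplicial_boundary z1 w \<noteq> 0"
      using nz dz2 by simp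
    then have "\<exists>v\<in>V. z1 (v # w) \<noteq> 0"
      using sum.neutral[of V "\<lambda>v. z1 (v # w)"] unfolding eq1 by blast
    then obtain u where u: "set (u # w) \<in> ?L"
      using supp1 by blast
    show ?thesis
      using v(1) S_down[OF v(2), of "set w"] L_down[OF u, of "set w"] by auto
  qed
  \<comment> \<open>The formula \<open>\<partial> y = z\<^sub>2 - C (\<partial> z\<^sub>2)\<close> leaves \<open>z' = z\<^sub>1 + C (\<partial> z\<^sub>2)\<close>, which is carried by the other cones.\<close>
  define y where "y = cone_chain (p i) z2"
  have y: "y \<in> simplicial_chains ?K (Suc m)"
    unfolding mem_simplicial_chains_iff[OF finK]
  proof (intro conjI allI impI)
    show "alternating y"
      unfolding y_def by (rule alternating_cone_chain[OF alt2])
    fix w assume "y w \<noteq> 0"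
    then obtain xs ys where w: "w = xs @ p i # ys" "z2 (xs @ ys) \<noteq> 0"
      unfolding y_def by (rule cone_chain_support)
    then have "length (xs @ ys) = m" "set (xs @ ys) \<in> S i"
      using supp2 by blast+
    with w(1) insert.prems(5)[of i i "set (xs @ ys)"]
    show "length w = Suc m" "set w \<in> ?K" by auto
  qed
  have dy: "simplicial_boundary y w = z2 w - cone_chain (p i) (simplicial_boundary z2) w" for w
    unfolding y_def using simplicial_boundary_cone_chain[OF fin(2) _ V2] insert.prems(4) by blast
  define z' where "z' = (\<lambda>w. z w + - simplicial_boundary y w)"
  have z': "z' = (\<lambda>w. z1 w + cone_chain (p i) (simplicial_boundary z2) w)"
    unfolding z'_def dy z_eq by simp
  have "z' \<in> simplicial_chains ?L m"
    unfolding mem_simplicial_chains_iff[OF finL]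
  proof (intro conjI allI impI)
    have "alternating (simplicial_boundary z2)"
      unfolding eq2 by (rule alternating_sum_Cons[OF alt2])
    then show "alternating z'"
      unfolding z' by (intro alternating_add alt1 alternating_cone_chain)
    fix w assume "z' w \<noteq> 0"
    then consider "z1 w \<noteq> 0" | "cone_chain (p i) (simplicial_boundary z2) w \<noteq> 0"
      unfolding z' by fastforce
    then have "length w = m \<and> set w \<in> ?L"
    proof cases
      case 2
      then obtain xs ys where w: "w = xs @ p i # ys" "simplicial_boundary z2 (xs @ ys) \<noteq> 0"
        by (rule cone_chain_support)
      then obtain j where j: "j \<in> J" "set (xs @ ys) \<in> S j" "set (xs @ ys) \<in> S i"
        and l: "Suc (length (xs @ ys)) = m"
        using supp_d by blast
      have "insert (p i) (set (xs @ ys)) \<in> S j"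
        using insert.prems(5)[of j i] j by blast
      with j(1) l w(1) show ?thesis by auto
    qed (rule supp1)
    then show "length w = m" "set w \<in> ?L" by blast+
  qed
  moreover have "simplicial_boundary z' = (\<lambda>w. 0)"
  proof
    fix w
    have "simplicial_boundary y \<in> simplicial_chains ?K m"
      by (rule simplicial_boundary_mem_chains[OF finK K_down y])
    then have yV: "set w \<subseteq> V" if "simplicial_boundary y w \<noteq> 0" for w
      using that KV unfolding mem_simplicial_chains_iff[OF finK] by blast
    have zV: "set w \<subseteq> V" if "z w \<noteq> 0" for w
      using z_supp[OF that] KV by blast
    have "simplicial_boundary z' w = simplicial_boundary z w
        + simplicial_boundary (\<lambda>w. - simplicial_boundary y w) w"
      unfolding z'_def by (rule simplicial_boundary_add[OF fin(2) zV]) (use yV in auto)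
    then show "simplicial_boundary z' w = 0"
      unfolding simplicial_boundary_uminus simplicial_boundary_boundary[OF finK y] dz by simp
  qed
  ultimately have "z' \<in> simplicial_cycles ?L m"
    by (simp add: simplicial_cycles_def)
  then have "\<exists>y'\<in>simplicial_chains ?L (Suc m). simplicial_boundary y' = z'"
    by (rule insert.IH[OF _ insert.prems(2-4)[OF insertI2] insert.prems(5)[OF insertI2 insertI2]])
  then obtain y' where y': "y' \<in> simplicial_chains ?L (Suc m)" "simplicial_boundary y' = z'"
    by blast
  then have y'K: "y' \<in> simplicial_chains ?K (Suc m)"
    using subsetD[OF simplicial_chains_mono[OF finK, of ?L]] by simp
  have supps: "set w \<subseteq> V" if "c \<in> simplicial_chains ?K (Suc m)" "c w \<noteq> 0" for c w
  proof -
    have "set w \<in> ?K"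
      using that unfolding mem_simplicial_chains_iff[OF finK] by blast
    then show ?thesis using KV by blast
  qed
  have "simplicial_boundary (\<lambda>w. y' w + y w) w = z w" for w
    using simplicial_boundary_add[OF fin(2) supps[OF y'K] supps[OF y]] y'(2) by (simp add: z'_def)
  then show ?case
    using simplicial_chains_add[OF finK y'K y] by (intro bexI[of _ "\<lambda>w. y' w + y w"]) auto
qed

section \<open>Rank of an abelian group\<close>

text \<open>A homogeneous integer system with more unknowns than equations has a nonzero integer solution, by
  fraction-free elimination of one equation and one unknown.\<close>

lemma integer_dependence:
  fixes A :: "'a \<Rightarrow> 'c \<Rightarrow> int"
  assumes "finite C" "finite S" "card C < card S"
  shows "\<exists>e. (\<exists>x\<in>S. e x \<noteq> 0) \<and> (\<forall>c\<in>C. (\<Sum>x\<in>S. e x * A x c) = 0)"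
  using assms
proof (induction C arbitrary: S A rule: finite_induct)
  case empty
  then have "S \<noteq> {}" by auto
  then show ?case by (intro exI[of _ "\<lambda>_. 1"]) auto
next
  case (insert c C)
  show ?case
  proof (cases "\<forall>x\<in>S. A x c = 0")
    case True
    obtain e where "\<exists>x\<in>S. e x \<noteq> 0" "\<forall>c\<in>C. (\<Sum>x\<in>S. e x * A x c) = 0"
      using insert.IH[of S A] insert.prems insert.hyps by auto
    with True show ?thesis by (intro exI[of _ e]) auto
  next
    case False
    then obtain p where p: "p \<in> S" "A p c \<noteq> 0" by blast
    let ?S = "S - {p}"
    have "card C < card ?S"
      using insert.prems insert.hyps p by simp
    then obtain e where e: "\<exists>x\<in>?S. e x \<noteq> 0"
      and 0: "\<And>d. d \<in> C \<Longrightarrow> (\<Sum>x\<in>?S. e x * (A p c * A x d - A x c * A p d)) = 0"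
      using insert.IH[of ?S "\<lambda>x d. A p c * A x d - A x c * A p d"] insert.prems by auto
    \<comment> \<open>The value at the pivot \<open>p\<close> is chosen to solve equation \<open>c\<close> after scaling by \<open>A p c\<close>.\<close>
    define f where "f x = (if x = p then - (\<Sum>x\<in>?S. e x * A x c) else e x * A p c)" for x
    have split: "(\<Sum>x\<in>S. f x * A x d) = - (\<Sum>x\<in>?S. e x * A x c) * A p d + (\<Sum>x\<in>?S. e x * A p c * A x d)"
      for d
    proof -
      have "(\<Sum>x\<in>?S. f x * A x d) = (\<Sum>x\<in>?S. e x * A p c * A x d)"
        by (intro sum.cong) (auto simp: f_def)
      then show ?thesis
        using insert.prems p by (simp add: sum.remove[of S p] f_def)
    qed
    have "(\<Sum>x\<in>S. f x * A x d) = 0" if d: "d \<in> insert c C" for d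
    proof (cases "d = c")
      case True
      then show ?thesis
        unfolding split by (simp add: True sum_distrib_left mult.commute mult.left_commute)
    next
      case False
      then have "(\<Sum>x\<in>?S. e x * (A p c * A x d - A x c * A p d)) = 0"
        using 0 d by blast
      then show ?thesis
        unfolding split by (simp add: sum_distrib_left right_diff_distrib sum_subtractf mult.commute mult.left_commute)
    qed
    moreover have "\<exists>x\<in>S. f x \<noteq> 0"
      using e p by (auto simp: f_def)
    ultimately show ?thesis by blast
  qed
qed

lemma (in comm_group) additive_map_finprod:
  fixes \<phi> :: "'a \<Rightarrow> int"
  assumes add: "\<And>x y. x \<in> carrier G \<Longrightarrow> y \<in> carrier G \<Longrightarrow> \<phi> (x \<otimes> y) = \<phi> x + \<phi> y"
    and "finite S" "S \<subseteq> carrier G"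
  shows "\<phi> (finprod G (\<lambda>x. x [^] (e x :: int)) S) = (\<Sum>x\<in>S. e x * \<phi> x)"
proof -
  have one: "\<phi> \<one> = 0"
    using add[of \<one> \<one>] by simp
  have nat: "\<phi> (x [^] n) = int n * \<phi> x" if "x \<in> carrier G" for x and n :: nat
    by (induction n) (simp_all add: one add that algebra_simps)
  have inv: "\<phi> (inv x) = - \<phi> x" if "x \<in> carrier G" for x
    using add[of x "inv x"] that one by simp
  have int: "\<phi> (x [^] k) = k * \<phi> x" if "x \<in> carrier G" for x and k :: int
  proof (cases k rule: int_cases2)
    case (nonneg n)
    show ?thesis
      unfolding nonneg int_pow_int by (rule nat[OF that])
  next
    case (nonpos n)
    show ?thesis
      unfolding nonpos int_pow_neg_int[OF that] inv[OF nat_pow_closed[OF that]] nat[OF that] by simp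
  qed
  from assms(2,3) show ?thesis
  proof (induction S rule: finite_induct)
    case (insert x S)
    then have "finprod G (\<lambda>x. x [^] e x) (insert x S)
        = (x [^] e x) \<otimes> finprod G (\<lambda>x. x [^] e x) S"
      by (intro finprod_insert) auto
    moreover have "finprod G (\<lambda>x. x [^] e x) S \<in> carrier G"
      using insert by (intro finprod_closed) auto
    ultimately show ?case
      using insert by (simp add: add int)
  qed (simp add: one)
qed

text \<open>The hypotheses say that the functionals \<open>\<phi> c\<close> identify the group with the free abelian group on
  \<open>C\<close>. Preimages of the basis are independent, and \<open>integer_dependence\<close> bounds every independent
  set.\<close>

lemma (in comm_group) abelian_rank_eq_card:
  fixes \<phi> :: "'c \<Rightarrow> 'a \<Rightarrow> int"
  assumes "finite C"
    and add: "\<And>c x y. c \<in> C \<Longrightarrow> x \<in> carrier G \<Longrightarrow> y \<in> carrier G \<Longrightarrow> \<phi> c (x \<otimes> y) = \<phi> c x + \<phi> c y"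
    and inj: "\<And>x. x \<in> carrier G \<Longrightarrow> (\<forall>c\<in>C. \<phi> c x = 0) \<Longrightarrow> x = \<one>"
    and surj: "\<And>c. c \<in> C \<Longrightarrow> \<exists>x\<in>carrier G. \<forall>d\<in>C. \<phi> d x = (if d = c then 1 else 0)"
  shows "abelian_rank G = card C"
  unfolding abelian_rank_def
proof (rule cSup_eq_maximum)
  obtain b where b: "\<And>c. c \<in> C \<Longrightarrow> b c \<in> carrier G"
    "\<And>c d. c \<in> C \<Longrightarrow> d \<in> C \<Longrightarrow> \<phi> d (b c) = (if d = c then 1 else 0)"
    using surj by metis
  have inj_b: "inj_on b C"
  proof (rule inj_onI)
    fix c d assume "c \<in> C" "d \<in> C" "b c = b d"
    then show "c = d" using b(2)[of c c] b(2)[of d c] by (auto split: if_splits)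
  qed
  have "int_independent G (b ` C)"
    unfolding int_independent_def
  proof (intro conjI allI impI ballI)
    fix e :: "'a \<Rightarrow> int" and x
    assume *: "finprod G (\<lambda>x. x [^] e x) (b ` C) = \<one>" and "x \<in> b ` C"
    then obtain d where d: "d \<in> C" "x = b d" by blast
    have "\<phi> d \<one> = 0"
      using add[OF d(1), of \<one> \<one>] by simp
    then have "0 = (\<Sum>x\<in>b ` C. e x * \<phi> d x)"
      using additive_map_finprod[of "\<phi> d" "b ` C" e] add[OF d(1)] b(1) \<open>finite C\<close> *
      by (auto simp: image_subset_iff)
    also have "\<dots> = (\<Sum>c\<in>C. if d = c then e (b c) else 0)"
      unfolding sum.reindex[OF inj_b] o_def using b(2) d(1) by (intro sum.cong) auto
    also have "\<dots> = e x"
      using d \<open>finite C\<close> by simp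
    finally show "e x = 0" by simp
  qed (use b(1) \<open>finite C\<close> in auto)
  then show "card C \<in> {card S |S. int_independent G S}"
    using card_image[OF inj_b] by (metis (mono_tags, lifting) mem_Collect_eq)
next
  fix n assume "n \<in> {card S |S. int_independent G S}"
  then obtain S where S: "n = card S" "int_independent G S" by blast
  then have fin: "finite S" and sub: "S \<subseteq> carrier G"
    and ind: "\<And>e :: 'a \<Rightarrow> int. finprod G (\<lambda>x. x [^] e x) S = \<one> \<Longrightarrow> \<forall>x\<in>S. e x = 0"
    unfolding int_independent_def by blast+
  show "n \<le> card C"
  proof (rule ccontr)
    assume "\<not> n \<le> card C"
    then obtain e where e: "\<exists>x\<in>S. e x \<noteq> 0" "\<forall>c\<in>C. (\<Sum>x\<in>S. e x * \<phi> c x) = 0"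
      using integer_dependence[OF \<open>finite C\<close> fin, of "\<lambda>x c. \<phi> c x"] S(1) by auto
    have "finprod G (\<lambda>x. x [^] e x) S = \<one>"
    proof (rule inj)
      show "finprod G (\<lambda>x. x [^] e x) S \<in> carrier G"
        using sub by (intro finprod_closed) auto
      show "\<forall>c\<in>C. \<phi> c (finprod G (\<lambda>x. x [^] e x) S) = 0"
      proof
        fix c assume c: "c \<in> C"
        have "\<phi> c (finprod G (\<lambda>x. x [^] e x) S) = (\<Sum>x\<in>S. e x * \<phi> c x)"
          by (rule additive_map_finprod[OF _ fin sub]) (rule add[OF c])
        then show "\<phi> c (finprod G (\<lambda>x. x [^] e x) S) = 0"
          using e(2) c by simp
      qed
    qed
    with ind e(1) show False by blast
  qed
qed

text \<open>The functionals vanish on \<open>H\<close>, so they descend to the cosets; their value on a coset is read off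
  from an arbitrary representative.\<close>

lemma (in comm_group) abelian_rank_Mod_eq_card:
  fixes \<phi> :: "'c \<Rightarrow> 'a \<Rightarrow> int"
  assumes H: "subgroup H G" and "finite C"
    and add: "\<And>c x y. c \<in> C \<Longrightarrow> x \<in> carrier G \<Longrightarrow> y \<in> carrier G \<Longrightarrow> \<phi> c (x \<otimes> y) = \<phi> c x + \<phi> c y"
    and ker: "\<And>x. x \<in> carrier G \<Longrightarrow> x \<in> H \<longleftrightarrow> (\<forall>c\<in>C. \<phi> c x = 0)"
    and surj: "\<And>c. c \<in> C \<Longrightarrow> \<exists>x\<in>carrier G. \<forall>d\<in>C. \<phi> d x = (if d = c then 1 else 0)"
  shows "abelian_rank (G Mod H) = card C"
proof -
  interpret N: normal H G
    using H by (rule subgroup_imp_normal)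
  interpret Q: comm_group "G Mod H"
    by (rule abelian_FactGroup[OF H])
  define \<psi> where "\<psi> c A = \<phi> c (SOME x. x \<in> A)" for c A
  have \<psi>: "\<psi> c (H #> x) = \<phi> c x" if "c \<in> C" "x \<in> carrier G" for c x
  proof -
    have "x \<in> H #> x"
      using rcos_self[OF that(2) H] .
    then have "(SOME y. y \<in> H #> x) \<in> H #> x"
      by (rule someI)
    then obtain h where h: "h \<in> H" "(SOME y. y \<in> H #> x) = h \<otimes> x"
      unfolding r_coset_def by blast
    then show ?thesis
      using add[OF that(1) N.mem_carrier[OF h(1)] that(2)] ker[OF N.mem_carrier[OF h(1)]] that(1)
      by (simp add: \<psi>_def)
  qed
  have car: "\<exists>x\<in>carrier G. A = H #> x" if "A \<in> carrier (G Mod H)" for A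
    using that unfolding FactGroup_def RCOSETS_def by auto
  have mem: "H #> x \<in> carrier (G Mod H)" if "x \<in> carrier G" for x
    using that unfolding FactGroup_def RCOSETS_def by auto
  show ?thesis
  proof (rule Q.abelian_rank_eq_card[OF \<open>finite C\<close>])
    fix c A B assume c: "c \<in> C" and "A \<in> carrier (G Mod H)" "B \<in> carrier (G Mod H)"
    then obtain x y where xy: "x \<in> carrier G" "A = H #> x" "y \<in> carrier G" "B = H #> y"
      using car by blast
    then have "A \<otimes>\<^bsub>G Mod H\<^esub> B = H #> (x \<otimes> y)"
      by (simp add: FactGroup_def N.rcos_sum)
    then show "\<psi> c (A \<otimes>\<^bsub>G Mod H\<^esub> B) = \<psi> c A + \<psi> c B"
      using xy c add by (simp add: \<psi>)
  next
    fix A assume "A \<in> carrier (G Mod H)" and 0: "\<forall>c\<in>C. \<psi> c A = 0"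
    then obtain x where x: "x \<in> carrier G" "A = H #> x"
      using car by blast
    then have "x \<in> H"
      using 0 ker \<psi> by simp
    then show "A = \<one>\<^bsub>G Mod H\<^esub>"
      using x N.rcos_const by (simp add: FactGroup_def)
  next
    fix c assume "c \<in> C"
    then obtain x where "x \<in> carrier G" "\<forall>d\<in>C. \<phi> d x = (if d = c then 1 else 0)"
      using surj by blast
    then show "\<exists>A\<in>carrier (G Mod H). \<forall>d\<in>C. \<psi> d A = (if d = c then 1 else 0)"
      using mem by (intro bexI[of _ "H #> x"]) (simp_all add: \<psi>)
  qed
qed

section \<open>Homology of an acyclic complex with facets attached\<close>

lemma simplicial_chains_uminus:
  assumes "finite (\<Union> K)" "c \<in> simplicial_chains K m"
  shows "(\<lambda>w. - c w) \<in> simplicial_chains K m"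
proof -
  have alt: "alternating c" and supp: "\<And>w. c w \<noteq> 0 \<Longrightarrow> length w = m \<and> set w \<in> K"
    using assms(2) unfolding mem_simplicial_chains_iff[OF assms(1)] by blast+
  have "alternating (\<lambda>w. - c w)"
    unfolding alternating_def by (intro allI arg_cong[where f = uminus] alternatingD[OF alt])
  then show ?thesis
    using supp unfolding mem_simplicial_chains_iff[OF assms(1)] by simp
qed

lemma zero_mem_simplicial_chains: "(\<lambda>w. 0) \<in> simplicial_chains K m"
  by (simp add: simplicial_chains_def)

lemma simplicial_chains_vertices:
  assumes "finite (\<Union> K)" "c \<in> simplicial_chains K m" "c w \<noteq> 0"
  shows "set w \<subseteq> \<Union> K"
  using assms unfolding mem_simplicial_chains_iff[OF assms(1)] by blast

lemma simplicial_boundary_add_chains: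
  assumes fin: "finite (\<Union> K)" and c: "c \<in> simplicial_chains K m" and d: "d \<in> simplicial_chains K m"
  shows "simplicial_boundary (\<lambda>w. c w + d w) = (\<lambda>w. simplicial_boundary c w + simplicial_boundary d w)"
proof
  fix w
  show "simplicial_boundary (\<lambda>w. c w + d w) w = simplicial_boundary c w + simplicial_boundary d w"
    by (rule simplicial_boundary_add[OF fin])
      (use simplicial_chains_vertices[OF fin c] simplicial_chains_vertices[OF fin d] in blast)+
qed

lemma simplicial_boundary_zero: "simplicial_boundary (\<lambda>w. 0) = (\<lambda>w. 0)"
  by (simp add: simplicial_boundary_def fun_eq_iff)

lemma comm_group_cycle_group:
  assumes fin: "finite (\<Union> K)"
  shows "comm_group (cycle_group K m)"
proof (rule comm_groupI)
  fix c d assume "c \<in> carrier (cycle_group K m)" "d \<in> carrier (cycle_group K m)"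
  then show "c \<otimes>\<^bsub>cycle_group K m\<^esub> d \<in> carrier (cycle_group K m)"
    by (auto simp: cycle_group_def simplicial_cycles_def simplicial_chains_add[OF fin]
        simplicial_boundary_add_chains[OF fin])
next
  show "\<one>\<^bsub>cycle_group K m\<^esub> \<in> carrier (cycle_group K m)"
    by (simp add: cycle_group_def simplicial_cycles_def zero_mem_simplicial_chains simplicial_boundary_zero)
next
  fix c assume c: "c \<in> carrier (cycle_group K m)"
  have "simplicial_boundary (\<lambda>w. - c w) = (\<lambda>w. 0)"
    using c simplicial_boundary_uminus[of c] by (simp add: cycle_group_def simplicial_cycles_def fun_eq_iff)
  then have "(\<lambda>w. - c w) \<in> carrier (cycle_group K m)"
    using c by (simp add: cycle_group_def simplicial_cycles_def simplicial_chains_uminus[OF fin])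
  then show "\<exists>d\<in>carrier (cycle_group K m). d \<otimes>\<^bsub>cycle_group K m\<^esub> c = \<one>\<^bsub>cycle_group K m\<^esub>"
    by (rule bexI[rotated]) (simp add: cycle_group_def)
qed (auto simp: cycle_group_def algebra_simps)

lemma subgroup_simplicial_boundaries:
  assumes fin: "finite (\<Union> K)" and down: "\<And>\<sigma> \<tau>. \<tau> \<in> K \<Longrightarrow> \<sigma> \<subseteq> \<tau> \<Longrightarrow> \<sigma> \<in> K"
  shows "subgroup (simplicial_boundaries K m) (cycle_group K m)"
proof -
  interpret comm_group "cycle_group K m"
    by (rule comm_group_cycle_group[OF fin])
  have sub: "simplicial_boundaries K m \<subseteq> carrier (cycle_group K m)"
    using simplicial_boundary_mem_chains[OF fin down] simplicial_boundary_boundary[OF fin]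
    by (auto simp: simplicial_boundaries_def cycle_group_def simplicial_cycles_def)
  show ?thesis
  proof (rule subgroupI[OF sub])
    show "simplicial_boundaries K m \<noteq> {}"
      using zero_mem_simplicial_chains unfolding simplicial_boundaries_def by blast
  next
    fix b assume b: "b \<in> simplicial_boundaries K m"
    then obtain c where c: "c \<in> simplicial_chains K (Suc m)" "b = simplicial_boundary c"
      unfolding simplicial_boundaries_def by blast
    have "simplicial_boundary (\<lambda>w. - c w) = (\<lambda>w. - b w)"
      unfolding c(2) by (rule ext) (rule simplicial_boundary_uminus)
    then have "(\<lambda>w. - b w) \<in> simplicial_boundaries K m"
      using simplicial_chains_uminus[OF fin c(1)] unfolding simplicial_boundaries_def
      by (intro image_eqI[where x = "\<lambda>w. - c w"]) simp_all
    moreover have "inv\<^bsub>cycle_group K m\<^esub> b = (\<lambda>w. - b w)"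
      by (rule inv_equality) (use b calculation sub in \<open>auto simp: cycle_group_def\<close>)
    ultimately show "inv\<^bsub>cycle_group K m\<^esub> b \<in> simplicial_boundaries K m"
      by simp
  next
    fix a b assume "a \<in> simplicial_boundaries K m" "b \<in> simplicial_boundaries K m"
    then obtain c d where c: "c \<in> simplicial_chains K (Suc m)" "a = simplicial_boundary c"
      and d: "d \<in> simplicial_chains K (Suc m)" "b = simplicial_boundary d"
      unfolding simplicial_boundaries_def by blast
    then show "a \<otimes>\<^bsub>cycle_group K m\<^esub> b \<in> simplicial_boundaries K m"
      using simplicial_boundary_add_chains[OF fin c(1) d(1)] simplicial_chains_add[OF fin c(1) d(1)]
      unfolding simplicial_boundaries_def cycle_group_def c(2) d(2)
      by (intro image_eqI[where x = "\<lambda>w. c w + d w"]) simp_all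
  qed
qed

text \<open>The chain \<open>[u\<^sub>0, \<dots>, u\<^sub>n]\<close>, obtained by iterated coning from the empty simplex; so the properties of
  the cone operator apply and no permutation has to be chosen.\<close>

definition oriented_simplex :: "'a list \<Rightarrow> 'a list \<Rightarrow> int" where
  "oriented_simplex u = foldr cone_chain u (\<lambda>w. if w = [] then 1 else 0)"

lemma alternating_oriented_simplex: "alternating (oriented_simplex u)"
  by (induction u)
    (simp_all add: oriented_simplex_def alternating_def[of "\<lambda>w. if w = [] then 1 else 0"]
      alternating_cone_chain)

lemma oriented_simplex_support:
  "oriented_simplex u w \<noteq> 0 \<Longrightarrow> length w = length u \<and> set w = set u"
proof (induction u arbitrary: w)
  case Nil
  then show ?case
    by (simp add: oriented_simplex_def split: if_splits)
next
  case (Cons v u)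
  then have "cone_chain v (oriented_simplex u) w \<noteq> 0"
    by (simp add: oriented_simplex_def)
  then obtain xs ys where "w = xs @ v # ys" "oriented_simplex u (xs @ ys) \<noteq> 0"
    by (rule cone_chain_support)
  then show ?case
    using Cons.IH[of "xs @ ys"] by auto
qed

lemma oriented_simplex_self:
  assumes "distinct u"
  shows "oriented_simplex u u = 1"
  using assms
proof (induction u)
  case (Cons v u)
  have "cone_chain v (\<lambda>w. oriented_simplex u (v # w)) u = 0"
  proof (rule ccontr)
    assume "\<not> ?thesis"
    then obtain xs ys where "oriented_simplex u (v # xs @ ys) \<noteq> 0"
      using cone_chain_support by metis
    then have "v \<in> set u"
      using oriented_simplex_support[of u "v # xs @ ys"] by auto
    with Cons.prems show False by simp
  qed
  then show ?case
    using Cons by (simp add: oriented_simplex_def)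
qed (simp add: oriented_simplex_def)

lemma alternating_vanishes_reorder:
  assumes "alternating c" "distinct u" "distinct w" "set u = set w" "c u = 0"
  shows "c w = 0"
proof -
  have "mset w = mset u"
    using assms(2-4) by (simp add: set_eq_iff_mset_eq_distinct)
  then obtain p where p: "p permutes {..<length u}" "permute_list p u = w"
    by (rule mset_eq_permutation)
  then show ?thesis
    using alternating_permute_list[OF assms(1) p(1)] assms(5) by simp
qed

text \<open>Let \<open>L\<close> be the acyclic union of the cones. Evaluation at the \<open>n\<close>-simplices outside \<open>L\<close> induces the
  isomorphism of \<open>H\<^sub>n\<close> with a free group. Boundaries vanish on these simplices since they are facets;
  a cycle vanishing on them is a cycle of \<open>L\<close>, hence a boundary. Conversely, all proper faces of such
  a facet \<open>\<tau>\<close> lie in \<open>L\<close>, so the boundary of \<open>\<tau>\<close> is also the boundary of a chain \<open>y\<close> of \<open>L\<close>, and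
  \<open>\<tau> - y\<close> is a cycle that is 1 on \<open>\<tau>\<close> and 0 on the other facets.\<close>

theorem reduced_betti_eq_card_facets_outside_cones:
  fixes S :: "'i \<Rightarrow> 'a set set"
  assumes fin: "finite J" "finite (\<Union> K)"
    and K_down: "\<And>\<sigma> \<tau>. \<tau> \<in> K \<Longrightarrow> \<sigma> \<subseteq> \<tau> \<Longrightarrow> \<sigma> \<in> K"
    and sub: "\<And>j. j \<in> J \<Longrightarrow> S j \<subseteq> K"
    and down: "\<And>j \<sigma> \<tau>. j \<in> J \<Longrightarrow> \<tau> \<in> S j \<Longrightarrow> \<sigma> \<subseteq> \<tau> \<Longrightarrow> \<sigma> \<in> S j"
    and apex: "\<And>j. j \<in> J \<Longrightarrow> p j \<in> \<Union> K"
    and cone: "\<And>i j \<tau>. i \<in> J \<Longrightarrow> j \<in> J \<Longrightarrow> \<tau> \<in> S i \<Longrightarrow> \<tau> \<in> S j \<Longrightarrow> insert (p j) \<tau> \<in> S i"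
    and facet: "\<And>\<sigma> \<tau>. \<tau> \<in> K - (\<Union>j\<in>J. S j) \<Longrightarrow> \<sigma> \<in> K \<Longrightarrow> \<tau> \<subseteq> \<sigma> \<Longrightarrow> \<sigma> = \<tau>"
  shows "reduced_betti n K = card {\<tau> \<in> K - (\<Union>j\<in>J. S j). card \<tau> = Suc n}"
proof -
  let ?L = "\<Union>j\<in>J. S j" and ?m = "Suc n"
  let ?C = "{\<tau> \<in> K - ?L. card \<tau> = ?m}"
  have LK: "?L \<subseteq> K" using sub by blast
  have finL: "finite (\<Union> ?L)"
    by (rule finite_subset[OF Union_mono[OF LK] fin(2)])
  have "K \<subseteq> Pow (\<Union> K)" by blast
  then have "finite K"
    using fin(2) by (meson finite_Pow_iff finite_subset)
  then have finC: "finite ?C" by simp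
  have acyclic: "\<exists>y\<in>simplicial_chains ?L (Suc m). simplicial_boundary y = z"
    if "z \<in> simplicial_cycles ?L m" for z m
    by (rule union_of_cones_acyclic[OF fin _ down apex cone that]) (use sub in blast)+
  note chains_iff = mem_simplicial_chains_iff[OF fin(2)] mem_simplicial_chains_iff[OF finL]
  have chains_LK: "c \<in> simplicial_chains K m" if "c \<in> simplicial_chains ?L m" for c m
    using simplicial_chains_mono[OF fin(2) LK] that by blast
  define ord where "ord \<tau> = (SOME w. distinct w \<and> set w = \<tau>)" for \<tau> :: "'a set"
  have ord: "distinct (ord \<tau>)" "set (ord \<tau>) = \<tau>" "length (ord \<tau>) = ?m" if "\<tau> \<in> ?C" for \<tau>
  proof -
    have "finite \<tau>"
      using that card.infinite by fastforce
    then have "\<exists>w. distinct w \<and> set w = \<tau>"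
      using finite_distinct_list by blast
    from someI_ex[OF this] show "distinct (ord \<tau>)" "set (ord \<tau>) = \<tau>"
      unfolding ord_def by blast+
    then show "length (ord \<tau>) = ?m"
      using that distinct_card by fastforce
  qed
  interpret comm_group "cycle_group K ?m"
    by (rule comm_group_cycle_group[OF fin(2)])
  have "abelian_rank (cycle_group K ?m Mod simplicial_boundaries K ?m) = card ?C"
  proof (rule abelian_rank_Mod_eq_card[where \<phi> = "\<lambda>\<tau> z. z (ord \<tau>)"])
    show "subgroup (simplicial_boundaries K ?m) (cycle_group K ?m)"
      by (rule subgroup_simplicial_boundaries[OF fin(2) K_down])
  next
    fix z assume "z \<in> carrier (cycle_group K ?m)"
    then have z: "z \<in> simplicial_chains K ?m" and dz: "simplicial_boundary z = (\<lambda>w. 0)"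
      by (simp_all add: cycle_group_def simplicial_cycles_def)
    show "z \<in> simplicial_boundaries K ?m \<longleftrightarrow> (\<forall>\<tau>\<in>?C. z (ord \<tau>) = 0)"
    proof
      assume "z \<in> simplicial_boundaries K ?m"
      then obtain y where y: "y \<in> simplicial_chains K (Suc ?m)" "z = simplicial_boundary y"
        unfolding simplicial_boundaries_def by blast
      show "\<forall>\<tau>\<in>?C. z (ord \<tau>) = 0"
      proof
        fix \<tau> assume \<tau>: "\<tau> \<in> ?C"
        have "y (v # ord \<tau>) = 0" for v
        proof (rule ccontr)
          assume nz: "y (v # ord \<tau>) \<noteq> 0"
          moreover have "alternating y"
            using y(1) unfolding chains_iff by blast
          ultimately have "set (v # ord \<tau>) \<in> K" "distinct (v # ord \<tau>)"
            using y(1) alternating_distinct unfolding chains_iff by blast+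
          then have "insert v \<tau> \<in> K" "v \<notin> \<tau>"
            using ord[OF \<tau>] by simp_all
          with facet[of \<tau> "insert v \<tau>"] \<tau> show False by blast
        qed
        then show "z (ord \<tau>) = 0"
          unfolding y(2) simplicial_boundary_def by simp
      qed
    next
      assume 0: "\<forall>\<tau>\<in>?C. z (ord \<tau>) = 0"
      have alt: "alternating z" and supp: "\<And>w. z w \<noteq> 0 \<Longrightarrow> length w = ?m \<and> set w \<in> K"
        using z unfolding chains_iff by blast+
      have "set w \<in> ?L" if nz: "z w \<noteq> 0" for w
      proof (rule ccontr)
        assume "set w \<notin> ?L"
        have dw: "distinct w"
          by (rule alternating_distinct[OF alt nz])
        have w: "set w \<in> ?C"
          using \<open>set w \<notin> ?L\<close> supp[OF nz] distinct_card[OF dw] by simp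
        have "z w = 0"
          using alternating_vanishes_reorder[OF alt ord(1)[OF w] dw ord(2)[OF w]] 0 w by blast
        with nz show False by blast
      qed
      then have "z \<in> simplicial_chains ?L ?m"
        using alt supp unfolding chains_iff by blast
      then have "z \<in> simplicial_cycles ?L ?m"
        using dz by (simp add: simplicial_cycles_def)
      from acyclic[OF this] show "z \<in> simplicial_boundaries K ?m"
        using chains_LK unfolding simplicial_boundaries_def by blast
    qed
  next
    fix \<tau> assume \<tau>: "\<tau> \<in> ?C"
    let ?e = "oriented_simplex (ord \<tau>)"
    have e: "?e \<in> simplicial_chains K ?m"
      using alternating_oriented_simplex[of "ord \<tau>"] oriented_simplex_support[of "ord \<tau>"] ord[OF \<tau>] \<tau> unfolding chains_iff by auto
    have "simplicial_boundary ?e \<in> simplicial_chains K n"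
      by (rule simplicial_boundary_mem_chains[OF fin(2) K_down e])
    moreover have "set w \<in> ?L" if nz: "simplicial_boundary ?e w \<noteq> 0" for w
    proof (rule ccontr)
      assume "set w \<notin> ?L"
      have "\<exists>v. ?e (v # w) \<noteq> 0"
      proof (rule ccontr)
        assume "\<not> ?thesis"
        with nz show False by (simp add: simplicial_boundary_def)
      qed
      then obtain v where v: "?e (v # w) \<noteq> 0" by blast
      have "set (v # w) = \<tau>"
        using oriented_simplex_support[OF v] ord[OF \<tau>] by blast
      moreover have "distinct (v # w)"
        by (rule alternating_distinct[OF alternating_oriented_simplex v])
      moreover have "set w \<in> K"
        using calculation(1) \<tau> K_down[of \<tau> "set w"] by auto
      ultimately show False
        using facet[of "set w" \<tau>] \<open>set w \<notin> ?L\<close> \<tau> by auto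
    qed
    ultimately have "simplicial_boundary ?e \<in> simplicial_chains ?L n"
      unfolding chains_iff by blast
    then have "simplicial_boundary ?e \<in> simplicial_cycles ?L n"
      by (simp add: simplicial_cycles_def simplicial_boundary_boundary[OF fin(2) e])
    then obtain y where y: "y \<in> simplicial_chains ?L ?m" "simplicial_boundary y = simplicial_boundary ?e"
      using acyclic by blast
    let ?x = "\<lambda>w. ?e w + - y w"
    have y': "(\<lambda>w. - y w) \<in> simplicial_chains K ?m"
      by (rule simplicial_chains_uminus[OF fin(2) chains_LK[OF y(1)]])
    have "?x \<in> simplicial_chains K ?m"
      by (rule simplicial_chains_add[OF fin(2) e y'])
    moreover have "simplicial_boundary ?x = (\<lambda>w. 0)"
      unfolding simplicial_boundary_add_chains[OF fin(2) e y'] simplicial_boundary_uminus y(2) by simp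
    ultimately have "?x \<in> carrier (cycle_group K ?m)"
      by (simp add: cycle_group_def simplicial_cycles_def)
    moreover have "?x (ord \<rho>) = (if \<rho> = \<tau> then 1 else 0)" if \<rho>: "\<rho> \<in> ?C" for \<rho>
    proof -
      have "y (ord \<rho>) = 0"
      proof (rule ccontr)
        assume "y (ord \<rho>) \<noteq> 0"
        then have "set (ord \<rho>) \<in> ?L"
          using y(1) unfolding chains_iff by blast
        with ord[OF \<rho>] \<rho> show False by simp
      qed
      moreover have "?e (ord \<rho>) = 0" if "\<rho> \<noteq> \<tau>"
        using oriented_simplex_support[of "ord \<tau>" "ord \<rho>"] ord[OF \<rho>] ord[OF \<tau>] that by blast
      ultimately show ?thesis
        using oriented_simplex_self[OF ord(1)[OF \<tau>]] by simp
    qed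
    ultimately show "\<exists>x\<in>carrier (cycle_group K ?m). \<forall>\<rho>\<in>?C. x (ord \<rho>) = (if \<rho> = \<tau> then 1 else 0)"
      by (intro bexI[of _ ?x] ballI)
  qed (use finC in \<open>simp_all add: cycle_group_def\<close>)
  then show ?thesis
    unfolding reduced_betti_def reduced_simplicial_homology_def .
qed

section \<open>Counting set partitions\<close>

lemma sum_over_subsets_by_card:
  fixes g :: "nat \<Rightarrow> int"
  assumes "finite A"
  shows "(\<Sum>J \<in> Pow A - {{}}. g (card J)) = (\<Sum>j = 1..card A. int (card A choose j) * g j)"
proof -
  let ?F = "Pow A - {{}}"
  have "card J \<in> {1..card A}" if "J \<in> ?F" for J
    using that assms finite_subset[of J A] card_mono[of A J] by (auto simp: Suc_le_eq card_gt_0_iff)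
  then have "card ` ?F \<subseteq> {1..card A}"
    by blast
  then have "(\<Sum>J\<in>?F. g (card J)) = (\<Sum>j = 1..card A. \<Sum>J | J \<in> ?F \<and> card J = j. g (card J))"
    by (intro sum.group[symmetric]) (simp_all add: assms)
  also have "\<dots> = (\<Sum>j = 1..card A. int (card A choose j) * g j)"
  proof (rule sum.cong[OF refl])
    fix j assume "j \<in> {1..card A}"
    then have "{J. J \<in> ?F \<and> card J = j} = {J. J \<subseteq> A \<and> card J = j}"
      by auto
    then have "card {J. J \<in> ?F \<and> card J = j} = card A choose j"
      using n_subsets[OF assms] by simp
    moreover have "(\<Sum>J | J \<in> ?F \<and> card J = j. g (card J)) = (\<Sum>J | J \<in> ?F \<and> card J = j. g j)"
      by (intro sum.cong) auto
    ultimately show "(\<Sum>J | J \<in> ?F \<and> card J = j. g (card J)) = int (card A choose j) * g j"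
      by simp
  qed
  finally show ?thesis .
qed

text \<open>A partition of \<open>A\<close> is determined by the complement \<open>J\<close> of the block that contains \<open>a\<close> and by the
  partition it induces on \<open>J\<close>. As \<open>Suc n\<close> blocks remain, \<open>J\<close> is nonempty.\<close>

lemma bij_betw_insert_block:
  assumes "a \<in> A"
  shows "bij_betw (\<lambda>(J, Q). insert (A - J) Q)
    (SIGMA J : Pow (A - {a}) - {{}}. {Q. partition_on J Q \<and> finite Q \<and> card Q = Suc n})
    {P. partition_on A P \<and> finite P \<and> card P = Suc (Suc n)}"
  unfolding bij_betw_def
proof
  have notin: "A - J \<notin> Q" if "J \<subseteq> A - {a}" "partition_on J Q" for J Q
    using that assms by (auto simp: partition_on_def)
  show "inj_on (\<lambda>(J, Q). insert (A - J) Q)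
    (SIGMA J : Pow (A - {a}) - {{}}. {Q. partition_on J Q \<and> finite Q \<and> card Q = Suc n})"
    (is "inj_on ?f ?D")
  proof (rule inj_onI)
    fix x x' assume x: "x \<in> ?D" "x' \<in> ?D" and f: "?f x = ?f x'"
    obtain J Q J' Q' where JQ: "x = (J, Q)" "x' = (J', Q')"
      by (metis surj_pair)
    then have J: "J \<subseteq> A - {a}" "partition_on J Q" and J': "J' \<subseteq> A - {a}" "partition_on J' Q'"
      and eq: "insert (A - J) Q = insert (A - J') Q'"
      using x f by auto
    have "a \<notin> B" if "B \<in> Q'" for B
      using that J' by (auto simp: partition_on_def)
    moreover have "a \<in> A - J" using J assms by blast
    moreover have "A - J \<in> insert (A - J') Q'"
      unfolding eq[symmetric] by (rule insertI1)
    ultimately have "A - J = A - J'"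
      by blast
    moreover from this have "J = J'"
      using J(1) J'(1) by blast
    ultimately show "x = x'"
      using JQ eq notin[OF J] notin[OF J'] by (simp add: insert_ident)
  qed
  show "(\<lambda>(J, Q). insert (A - J) Q) `
    (SIGMA J : Pow (A - {a}) - {{}}. {Q. partition_on J Q \<and> finite Q \<and> card Q = Suc n})
    = {P. partition_on A P \<and> finite P \<and> card P = Suc (Suc n)}" (is "?f ` ?D = ?E")
  proof
    show "?f ` ?D \<subseteq> ?E"
    proof
      fix P assume "P \<in> ?f ` ?D"
      then obtain J Q where J: "J \<subseteq> A - {a}" "partition_on J Q" and Q: "finite Q" "card Q = Suc n"
        and P: "P = insert (A - J) Q"
        by auto
      have "A - (A - J) = J" "disjnt (A - J) (\<Union> Q)" "A - J \<noteq> {}"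
        using J(1) partition_onD1[OF J(2)] assms unfolding disjnt_iff by blast+
      then have "partition_on A (insert (A - J) Q)"
        using J(2) by (simp add: partition_on_insert)
      then show "P \<in> ?E"
        using P Q notin[OF J] by simp
    qed
    show "?E \<subseteq> ?f ` ?D"
    proof
      fix P assume "P \<in> ?E"
      then have P: "partition_on A P" "finite P" "card P = Suc (Suc n)" by auto
      obtain B where B: "B \<in> P" "a \<in> B"
        using P(1) assms by (auto simp: partition_on_def)
      let ?J = "A - B" and ?Q = "P - {B}"
      have "P = insert B ?Q" using B by blast
      have "disjnt B (\<Union> ?Q)"
        using P(1) B by (auto simp: partition_on_def pairwise_def disjnt_iff)
      with P(1) \<open>P = insert B ?Q\<close> have Q: "partition_on ?J ?Q" "B \<subseteq> A"
        using partition_on_insert[of B ?Q A] by simp_all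
      have cQ: "card ?Q = Suc n"
        using P B by simp
      then have "?Q \<noteq> {}"
        by (metis card.empty nat.distinct(1))
      then have "?J \<noteq> {}"
        using Q(1) partition_on_empty by metis
      then have D: "(?J, ?Q) \<in> ?D"
        using Q(1) P(2) cQ B by auto
      have "?f (?J, ?Q) = P"
        using Q(2) B by (simp add: double_diff insert_absorb)
      from rev_image_eqI[where f = ?f, OF D this[symmetric]] show "P \<in> ?f ` ?D" .
    qed
  qed
qed

theorem card_partitions_eq_betti_coeff:
  assumes "finite A" "A \<noteq> {}"
  shows "int (card {P. partition_on A P \<and> finite P \<and> card P = Suc n}) = betti_coeff n (card A)"
  using assms
proof (induction n arbitrary: A)
  case 0
  have "P = {A}" if "partition_on A P" "card P = Suc 0" for P
    using that by (auto simp: card_1_singleton_iff partition_on_def)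
  moreover have "partition_on A {A}" "finite {A}" "card {A} = Suc 0"
    using partition_on_space[OF 0(2)] by simp_all
  ultimately have "{P. partition_on A P \<and> finite P \<and> card P = Suc 0} = {{A}}"
    by blast
  then show ?case by simp
next
  case (Suc n)
  then obtain a where a: "a \<in> A" by blast
  let ?B = "A - {a}"
  let ?D = "\<lambda>J. {Q. partition_on J Q \<and> finite Q \<and> card Q = Suc n}"
  have finB: "finite ?B" using Suc by simp
  have "card {P. partition_on A P \<and> finite P \<and> card P = Suc (Suc n)}
      = card (SIGMA J : Pow ?B - {{}}. ?D J)"
    using bij_betw_same_card[OF bij_betw_insert_block[OF a]] by simp
  also have "\<dots> = (\<Sum>J \<in> Pow ?B - {{}}. card (?D J))"
  proof (rule card_SigmaI)
    show "\<forall>J\<in>Pow ?B - {{}}. finite (?D J)"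
    proof
      fix J assume "J \<in> Pow ?B - {{}}"
      then have "finite J" using finB finite_subset by blast
      show "finite (?D J)"
        by (rule finite_subset[OF _ finitely_many_partition_on[OF \<open>finite J\<close>]]) blast
    qed
  qed (use finB in simp)
  also have "int \<dots> = (\<Sum>J \<in> Pow ?B - {{}}. betti_coeff n (card J))"
    unfolding of_nat_sum
  proof (rule sum.cong[OF refl])
    fix J assume "J \<in> Pow ?B - {{}}"
    then show "int (card (?D J)) = betti_coeff n (card J)"
      using finB finite_subset by (intro Suc.IH) blast+
  qed
  also have "\<dots> = betti_coeff (Suc n) (card A)"
    using sum_over_subsets_by_card[OF finB, of "betti_coeff n"] Suc.prems a by simp
  finally show ?case .
qed

section \<open>Socles of finite local rings\<close>

lemma (in cring) exists_maximalideal_containing: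
  assumes "finite (carrier R)" "ideal I R" "I \<noteq> carrier R"
  shows "\<exists>M. maximalideal M R \<and> I \<subseteq> M"
proof -
  let ?P = "{J. ideal J R \<and> J \<noteq> carrier R}"
  have "?P \<subseteq> Pow (carrier R)"
    by (auto dest: ideal.Icarr)
  then have "finite ?P"
    by (rule finite_subset) (simp add: assms(1))
  then obtain M where M: "M \<in> ?P" "I \<subseteq> M" "\<And>J. J \<in> ?P \<Longrightarrow> M \<subseteq> J \<Longrightarrow> M = J"
    using finite_has_maximal2[of ?P I] assms(2,3) by auto
  have "maximalideal M R"
    by (rule maximalidealI) (use M in auto)
  with M(2) show ?thesis by blast
qed

lemma (in cring) mult_Unit_eq_zero:
  assumes "u \<in> Units R" "b \<in> carrier R" "u \<otimes> b = \<zero>"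
  shows "b = \<zero>"
proof -
  have "inv u \<otimes> (u \<otimes> b) = (inv u \<otimes> u) \<otimes> b"
    using assms(1,2) by (simp only: m_assoc Units_inv_closed Units_closed)
  also have "\<dots> = b"
    using assms(1,2) by simp
  finally have "b = inv u \<otimes> (u \<otimes> b)" by simp
  then show ?thesis
    using assms by simp
qed

text \<open>In a finite ring every nonunit lies in a maximal ideal. There is only one such ideal, and if it
  contained both \<open>a\<close> and \<open>1 - a r\<close> it would contain 1.\<close>

lemma (in cring) local_ring_one_minus_nonunit:
  assumes loc: "local_ring R" and fin: "finite (carrier R)"
    and a: "a \<in> carrier R" "a \<notin> Units R" and r: "r \<in> carrier R"
  shows "\<one> \<ominus> a \<otimes> r \<in> Units R"
proof (rule ccontr)
  have in_max: "\<exists>M. maximalideal M R \<and> x \<in> M" if x: "x \<in> carrier R" "x \<notin> Units R" for x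
  proof -
    have "\<one> \<notin> PIdl x"
    proof
      assume "\<one> \<in> PIdl x"
      then obtain y where y: "y \<in> carrier R" "y \<otimes> x = \<one>"
        unfolding cgenideal_def by force
      then have "x \<otimes> y = \<one>"
        using m_comm[OF x(1) y(1)] by simp
      with x(1) y have "x \<in> Units R"
        unfolding Units_def by blast
      with x(2) show False by blast
    qed
    then have "PIdl x \<noteq> carrier R" by auto
    then show ?thesis
      using exists_maximalideal_containing[OF fin cgenideal_ideal[OF x(1)]] cgenideal_self[OF x(1)]
      by blast
  qed
  assume nu: "\<one> \<ominus> a \<otimes> r \<notin> Units R"
  obtain M where M: "maximalideal M R" "a \<in> M"
    using in_max[OF a] by blast
  obtain N where N: "maximalideal N R" "\<one> \<ominus> a \<otimes> r \<in> N"
    using in_max[OF _ nu] a r by auto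
  have "M = N"
    using loc M(1) N(1) unfolding local_ring_def by blast
  interpret M: maximalideal M R by fact
  have "a \<otimes> r \<in> M"
    using M.I_r_closed[OF M(2) r] .
  then have "(\<one> \<ominus> a \<otimes> r) \<oplus> a \<otimes> r \<in> M"
    using N(2) \<open>M = N\<close> by (intro M.a_closed) simp_all
  moreover have "(\<one> \<ominus> a \<otimes> r) \<oplus> a \<otimes> r = \<one>"
    using a r by (simp add: minus_eq a_assoc l_neg)
  ultimately have "\<one> \<in> M" by simp
  then show False
    using M.one_imp_carrier M.I_notcarr by blast
qed

lemma local_ring_one_not_zero:
  assumes "local_ring R"
  shows "\<one>\<^bsub>R\<^esub> \<noteq> \<zero>\<^bsub>R\<^esub>"
proof
  assume *: "\<one>\<^bsub>R\<^esub> = \<zero>\<^bsub>R\<^esub>"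
  obtain M where M: "maximalideal M R"
    using assms unfolding local_ring_def by blast
  interpret M: maximalideal M R by fact
  have "\<one>\<^bsub>R\<^esub> \<in> M"
    using * M.zero_closed by simp
  then show False
    using M.one_imp_carrier M.I_notcarr by blast
qed

text \<open>A generator \<open>s\<close> of a smallest nonzero principal ideal has this property. If \<open>s a \<noteq> 0\<close> then
  minimality gives \<open>(s a) = (s)\<close>, so \<open>s (1 - a r) = 0\<close> for some \<open>r\<close>, while \<open>1 - a r\<close> is a unit when
  \<open>a\<close> is not. If \<open>s\<close> itself were a unit, every nonunit would be zero and the ring a field.\<close>

lemma local_ring_socle_element:
  fixes R (structure)
  assumes loc: "local_ring R" and fin: "finite (carrier R)" and "\<not> field R"
  obtains s where "s \<in> carrier R" "s \<noteq> \<zero>\<^bsub>R\<^esub>" "s \<notin> Units R"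
    "\<And>a. a \<in> carrier R \<Longrightarrow> a \<notin> Units R \<Longrightarrow> s \<otimes>\<^bsub>R\<^esub> a = \<zero>\<^bsub>R\<^esub>"
proof -
  interpret cring R using loc unfolding local_ring_def by blast
  have "\<one> \<noteq> \<zero>" by (rule local_ring_one_not_zero[OF loc])
  then obtain s where s: "s \<in> carrier R" "s \<noteq> \<zero>"
    and min: "\<And>t. t \<in> carrier R \<Longrightarrow> t \<noteq> \<zero> \<Longrightarrow> card (PIdl s) \<le> card (PIdl t)"
    using ex_has_least_nat[of "\<lambda>t. t \<in> carrier R \<and> t \<noteq> \<zero>" \<one> "\<lambda>t. card (PIdl t)"] by auto
  have kill: "s \<otimes> a = \<zero>" if a: "a \<in> carrier R" "a \<notin> Units R" for a
  proof (rule ccontr)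
    assume nz: "s \<otimes> a \<noteq> \<zero>"
    have "s \<otimes> a \<in> PIdl s"
      using s(1) a(1) by (auto simp: cgenideal_def m_comm)
    then have sub: "PIdl (s \<otimes> a) \<subseteq> PIdl s"
      using cgenideal_minimal[OF cgenideal_ideal[OF s(1)]] by blast
    have "finite (PIdl s)"
      using finite_subset[OF _ fin] s(1) by (auto simp: cgenideal_def)
    then have "PIdl (s \<otimes> a) = PIdl s"
      using sub min[OF _ nz] s(1) a(1) by (intro card_seteq) auto
    then have "s \<in> PIdl (s \<otimes> a)"
      using cgenideal_self[OF s(1)] by simp
    then obtain r where r: "r \<in> carrier R" "s = r \<otimes> (s \<otimes> a)"
      unfolding cgenideal_def by blast
    then have sar: "s \<otimes> (a \<otimes> r) = s"
      using s(1) a(1) by (simp add: m_assoc m_comm m_lcomm)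
    have "(\<one> \<ominus> a \<otimes> r) \<otimes> s = s \<ominus> s \<otimes> (a \<otimes> r)"
      using s(1) a(1) r(1) by algebra
    also have "\<dots> = \<zero>"
      unfolding sar using s(1) by (simp add: minus_eq r_neg)
    finally have "s = \<zero>"
      by (rule mult_Unit_eq_zero[OF local_ring_one_minus_nonunit[OF loc fin a r(1)] s(1)])
    with s(2) show False by blast
  qed
  have "s \<notin> Units R"
  proof
    assume u: "s \<in> Units R"
    have "a = \<zero>" if "a \<in> carrier R" "a \<notin> Units R" for a
      by (rule mult_Unit_eq_zero[OF u that(1) kill[OF that]])
    moreover have "\<zero> \<notin> Units R"
      using \<open>\<one> \<noteq> \<zero>\<close> by (auto simp: Units_def)
    ultimately have "Units R = carrier R - {\<zero>}"
      by auto
    with \<open>\<not> field R\<close> show False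
      using cring_fieldI by blast
  qed
  with s kill show ?thesis by (intro that) auto
qed

section \<open>Cliques in a product of local rings\<close>

text \<open>The ring \<open>\<Omega>\<close> is identified with the product of the factors through its coordinate functions \<open>\<pi> i\<close>,
  and \<open>s i\<close> is a nonzero nonunit of the factor \<open>R i\<close> annihilated by all nonunits.\<close>

locale finite_ring_product = cring \<Omega>
  for \<Omega> :: "('a, 'm) ring_scheme" (structure) +
  fixes k :: nat and R :: "nat \<Rightarrow> ('b, 'r) ring_scheme" and \<pi> :: "nat \<Rightarrow> 'a \<Rightarrow> 'b" and s :: "nat \<Rightarrow> 'b"
  assumes finite_carrier: "finite (carrier \<Omega>)"
    and factor_cring: "i < k \<Longrightarrow> cring (R i)"
    and factor_nontrivial: "i < k \<Longrightarrow> \<one>\<^bsub>R i\<^esub> \<noteq> \<zero>\<^bsub>R i\<^esub>"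
    and proj_closed: "i < k \<Longrightarrow> a \<in> carrier \<Omega> \<Longrightarrow> \<pi> i a \<in> carrier (R i)"
    and proj_mult: "i < k \<Longrightarrow> a \<in> carrier \<Omega> \<Longrightarrow> b \<in> carrier \<Omega> \<Longrightarrow> \<pi> i (a \<otimes> b) = \<pi> i a \<otimes>\<^bsub>R i\<^esub> \<pi> i b"
    and proj_zero: "i < k \<Longrightarrow> \<pi> i \<zero> = \<zero>\<^bsub>R i\<^esub>"
    and proj_eqI: "a \<in> carrier \<Omega> \<Longrightarrow> b \<in> carrier \<Omega> \<Longrightarrow> (\<And>i. i < k \<Longrightarrow> \<pi> i a = \<pi> i b) \<Longrightarrow> a = b"
    and proj_surj: "(\<And>i. i < k \<Longrightarrow> f i \<in> carrier (R i)) \<Longrightarrow> \<exists>a\<in>carrier \<Omega>. \<forall>i<k. \<pi> i a = f i"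
    and s_closed: "i < k \<Longrightarrow> s i \<in> carrier (R i)"
    and s_nonzero: "i < k \<Longrightarrow> s i \<noteq> \<zero>\<^bsub>R i\<^esub>"
    and s_nonunit: "i < k \<Longrightarrow> s i \<notin> Units (R i)"
    and s_annihilates: "i < k \<Longrightarrow> x \<in> carrier (R i) \<Longrightarrow> x \<notin> Units (R i) \<Longrightarrow> s i \<otimes>\<^bsub>R i\<^esub> x = \<zero>\<^bsub>R i\<^esub>"
begin

definition tuple :: "(nat \<Rightarrow> 'b) \<Rightarrow> 'a" where
  "tuple f = (SOME a. a \<in> carrier \<Omega> \<and> (\<forall>i<k. \<pi> i a = f i))"

definition unit_support :: "'a \<Rightarrow> nat set" where
  "unit_support a = {i. i < k \<and> \<pi> i a \<in> Units (R i)}"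

definition socle_vertex :: "nat \<Rightarrow> 'a" where
  "socle_vertex j = tuple (\<lambda>i. if i = j then s j else \<zero>\<^bsub>R i\<^esub>)"

definition unit_block :: "(nat \<Rightarrow> 'b) \<Rightarrow> nat set \<Rightarrow> 'a" where
  "unit_block x B = tuple (\<lambda>i. if i \<in> B then x i else \<zero>\<^bsub>R i\<^esub>)"

lemma tuple:
  assumes "\<And>i. i < k \<Longrightarrow> f i \<in> carrier (R i)"
  shows "tuple f \<in> carrier \<Omega>" and "i < k \<Longrightarrow> \<pi> i (tuple f) = f i"
proof -
  have "\<exists>a. a \<in> carrier \<Omega> \<and> (\<forall>i<k. \<pi> i a = f i)"
    using proj_surj[OF assms] by blast
  from someI_ex[OF this] show "tuple f \<in> carrier \<Omega>" "i < k \<Longrightarrow> \<pi> i (tuple f) = f i"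
    unfolding tuple_def by blast+
qed

lemma factor_zero: "i < k \<Longrightarrow> \<zero>\<^bsub>R i\<^esub> \<in> carrier (R i)"
  using factor_cring by (simp add: cring.cring_simprules)

lemma factor_zero_nonunit:
  assumes "i < k"
  shows "\<zero>\<^bsub>R i\<^esub> \<notin> Units (R i)"
proof -
  interpret Ri: cring "R i" by (rule factor_cring[OF assms])
  show ?thesis
    using factor_nontrivial[OF assms] by (auto simp: Units_def)
qed

lemma factor_unit_mult_eq_zero:
  assumes "i < k" "u \<in> Units (R i)" "b \<in> carrier (R i)" "u \<otimes>\<^bsub>R i\<^esub> b = \<zero>\<^bsub>R i\<^esub>"
  shows "b = \<zero>\<^bsub>R i\<^esub>"
  using cring.mult_Unit_eq_zero[OF factor_cring[OF assms(1)] assms(2-4)] .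

lemma eq_zeroI: "a \<in> carrier \<Omega> \<Longrightarrow> (\<And>i. i < k \<Longrightarrow> \<pi> i a = \<zero>\<^bsub>R i\<^esub>) \<Longrightarrow> a = \<zero>"
  by (rule proj_eqI) (simp_all add: proj_zero)

lemma proj_eq_zero_of_unit:
  assumes "a \<in> carrier \<Omega>" "b \<in> carrier \<Omega>" "a \<otimes> b = \<zero>" "i \<in> unit_support a"
  shows "\<pi> i b = \<zero>\<^bsub>R i\<^esub>"
proof (rule factor_unit_mult_eq_zero)
  show i: "i < k" "\<pi> i a \<in> Units (R i)"
    using assms(4) by (simp_all add: unit_support_def)
  show "\<pi> i b \<in> carrier (R i)"
    by (rule proj_closed[OF i(1) assms(2)])
  show "\<pi> i a \<otimes>\<^bsub>R i\<^esub> \<pi> i b = \<zero>\<^bsub>R i\<^esub>"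
    using proj_mult[OF i(1) assms(1,2)] assms(3) proj_zero[OF i(1)] by simp
qed

lemma socle_vertex:
  assumes "j < k"
  shows "socle_vertex j \<in> carrier \<Omega>"
    and "i < k \<Longrightarrow> \<pi> i (socle_vertex j) = (if i = j then s j else \<zero>\<^bsub>R i\<^esub>)"
proof -
  have "(if i = j then s j else \<zero>\<^bsub>R i\<^esub>) \<in> carrier (R i)" if "i < k" for i
    using that assms s_closed factor_zero by simp
  note tuple[OF this]
  then show "socle_vertex j \<in> carrier \<Omega>"
    and "i < k \<Longrightarrow> \<pi> i (socle_vertex j) = (if i = j then s j else \<zero>\<^bsub>R i\<^esub>)"
    unfolding socle_vertex_def by blast+
qed

lemma unit_support_socle_vertex: "j < k \<Longrightarrow> unit_support (socle_vertex j) = {}"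
  by (auto simp: unit_support_def socle_vertex s_nonunit factor_zero_nonunit split: if_splits)

lemma socle_vertex_mult:
  assumes j: "j < k" and a: "a \<in> carrier \<Omega>" "j \<notin> unit_support a"
  shows "socle_vertex j \<otimes> a = \<zero>"
proof (rule eq_zeroI)
  show "socle_vertex j \<otimes> a \<in> carrier \<Omega>"
    using socle_vertex(1)[OF j] a(1) by simp
  fix i assume i: "i < k"
  interpret Ri: cring "R i" by (rule factor_cring[OF i])
  have "\<pi> i (socle_vertex j \<otimes> a) = (if i = j then s j else \<zero>\<^bsub>R i\<^esub>) \<otimes>\<^bsub>R i\<^esub> \<pi> i a"
    by (simp only: proj_mult[OF i socle_vertex(1)[OF j] a(1)] socle_vertex(2)[OF j i])
  then show "\<pi> i (socle_vertex j \<otimes> a) = \<zero>\<^bsub>R i\<^esub>"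
    using a i s_annihilates proj_closed by (auto simp: unit_support_def)
qed

text \<open>The vertex is a zero divisor because its square is zero; so this works also for \<open>k = 1\<close>.\<close>

lemma socle_vertex_is_vertex:
  assumes "j < k"
  shows "socle_vertex j \<in> nonzero_zero_divisors \<Omega>"
proof -
  have "socle_vertex j \<noteq> \<zero>"
    using socle_vertex(2)[OF assms assms] s_nonzero[OF assms] proj_zero[OF assms] by auto
  moreover have "socle_vertex j \<otimes> socle_vertex j = \<zero>"
    using socle_vertex_mult[OF assms socle_vertex(1)[OF assms]] unit_support_socle_vertex[OF assms] by simp
  ultimately show ?thesis
    using socle_vertex(1)[OF assms] unfolding nonzero_zero_divisors_def by blast
qed

abbreviation K :: "'a set set" where "K \<equiv> zero_divisor_complex \<Omega>"

lemma vertices_subset_carrier: "nonzero_zero_divisors \<Omega> \<subseteq> carrier \<Omega>"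
  by (auto simp: nonzero_zero_divisors_def)

lemma mem_zero_divisor_complex_iff:
  "\<tau> \<in> K \<longleftrightarrow> \<tau> \<subseteq> nonzero_zero_divisors \<Omega> \<and> (\<forall>a\<in>\<tau>. \<forall>b\<in>\<tau>. a \<noteq> b \<longrightarrow> a \<otimes> b = \<zero>)"
proof -
  have "finite \<tau>" if "\<tau> \<subseteq> nonzero_zero_divisors \<Omega>"
    using finite_subset[OF subset_trans[OF that vertices_subset_carrier] finite_carrier] .
  then show ?thesis
    unfolding zero_divisor_complex_def clique_complex_def zero_divisor_graph_def by auto
qed

lemma clique_vertexD:
  assumes "\<tau> \<in> K" "a \<in> \<tau>"
  shows "a \<in> carrier \<Omega>" "a \<noteq> \<zero>"
  using assms unfolding mem_zero_divisor_complex_iff nonzero_zero_divisors_def by blast+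

lemma clique_multD: "\<tau> \<in> K \<Longrightarrow> a \<in> \<tau> \<Longrightarrow> b \<in> \<tau> \<Longrightarrow> a \<noteq> b \<Longrightarrow> a \<otimes> b = \<zero>"
  unfolding mem_zero_divisor_complex_iff by blast

text \<open>By \<open>insert_socle_vertex\<close> this is a cone with apex \<open>socle_vertex j\<close>. The apex has no unit
  coordinate, so adding it does not leave any other \<open>cone_at i\<close>.\<close>

definition cone_at :: "nat \<Rightarrow> 'a set set" where
  "cone_at j = {\<tau> \<in> K. \<forall>a\<in>\<tau>. j \<notin> unit_support a}"

lemma insert_socle_vertex:
  assumes j: "j < k" and \<tau>: "\<tau> \<in> cone_at j"
  shows "insert (socle_vertex j) \<tau> \<in> K"
proof -
  have \<tau>K: "\<tau> \<subseteq> nonzero_zero_divisors \<Omega>" "\<And>a b. a \<in> \<tau> \<Longrightarrow> b \<in> \<tau> \<Longrightarrow> a \<noteq> b \<Longrightarrow> a \<otimes> b = \<zero>"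
    using \<tau> unfolding cone_at_def mem_zero_divisor_complex_iff by blast+
  have "socle_vertex j \<otimes> a = \<zero> \<and> a \<otimes> socle_vertex j = \<zero>" if "a \<in> \<tau>" for a
  proof -
    have a: "a \<in> carrier \<Omega>" "j \<notin> unit_support a"
      using that \<tau>K(1) vertices_subset_carrier \<tau> unfolding cone_at_def by blast+
    from socle_vertex_mult[OF j this] show ?thesis
      using m_comm[OF a(1) socle_vertex(1)[OF j]] by simp
  qed
  then show ?thesis
    using \<tau>K socle_vertex_is_vertex[OF j] unfolding mem_zero_divisor_complex_iff by blast
qed

lemma mem_cones_iff:
  assumes "\<tau> \<in> K"
  shows "\<tau> \<notin> (\<Union>j\<in>{..<k}. cone_at j) \<longleftrightarrow> (\<Union>a\<in>\<tau>. unit_support a) = {..<k}"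
  using assms unfolding cone_at_def by (auto simp: unit_support_def)

text \<open>A further vertex would be annihilated by a unit in each coordinate, hence be zero.\<close>

lemma covering_clique_is_facet:
  assumes \<tau>: "\<tau> \<in> K" "(\<Union>a\<in>\<tau>. unit_support a) = {..<k}" and \<rho>: "\<rho> \<in> K" "\<tau> \<subseteq> \<rho>"
  shows "\<rho> = \<tau>"
proof (rule ccontr)
  assume "\<rho> \<noteq> \<tau>"
  then obtain b where b: "b \<in> \<rho>" "b \<notin> \<tau>"
    using \<rho>(2) by blast
  have "b = \<zero>"
  proof (rule eq_zeroI)
    show b_car: "b \<in> carrier \<Omega>"
      by (rule clique_vertexD(1)[OF \<rho>(1) b(1)])
    fix i assume "i < k"
    then obtain a where a: "a \<in> \<tau>" "i \<in> unit_support a"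
      using \<tau>(2) by blast
    then have "a \<in> \<rho>" "a \<noteq> b"
      using \<rho>(2) b(2) by blast+
    then show "\<pi> i b = \<zero>\<^bsub>R i\<^esub>"
      using clique_vertexD(1)[OF \<rho>(1)] clique_multD[OF \<rho>(1) _ b(1)] b_car
      by (intro proj_eq_zero_of_unit[OF _ _ _ a(2)])
  qed
  with clique_vertexD(2)[OF \<rho>(1) b(1)] show False ..
qed

theorem reduced_betti_eq_card_covering_cliques:
  "reduced_betti n K = card {\<tau> \<in> K. (\<Union>a\<in>\<tau>. unit_support a) = {..<k} \<and> card \<tau> = Suc n}"
proof -
  have "reduced_betti n K = card {\<tau> \<in> K - (\<Union>j\<in>{..<k}. cone_at j). card \<tau> = Suc n}"
  proof (rule reduced_betti_eq_card_facets_outside_cones[where p = socle_vertex])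
    have "\<Union> K \<subseteq> carrier \<Omega>"
      using clique_vertexD(1) by blast
    then show "finite (\<Union> K)"
      using finite_carrier finite_subset by blast
  next
    fix j assume j: "j \<in> {..<k}"
    have "{socle_vertex j} \<in> K"
      using socle_vertex_is_vertex j by (simp add: mem_zero_divisor_complex_iff)
    then show "socle_vertex j \<in> \<Union> K" by blast
    show "cone_at j \<subseteq> K" by (auto simp: cone_at_def)
    show "\<rho> \<in> cone_at j" if "\<tau> \<in> cone_at j" "\<rho> \<subseteq> \<tau>" for \<rho> \<tau>
      using that unfolding cone_at_def mem_zero_divisor_complex_iff by blast
    show "insert (socle_vertex j) \<tau> \<in> cone_at i"
      if "i \<in> {..<k}" "\<tau> \<in> cone_at i" "\<tau> \<in> cone_at j" for i \<tau>
      using that j insert_socle_vertex[of j \<tau>] unit_support_socle_vertex[of j]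
      unfolding cone_at_def by simp
  next
    fix \<rho> \<tau> assume \<tau>: "\<tau> \<in> K - (\<Union>j\<in>{..<k}. cone_at j)" and \<rho>: "\<rho> \<in> K" "\<tau> \<subseteq> \<rho>"
    have "(\<Union>a\<in>\<tau>. unit_support a) = {..<k}"
      by (rule iffD1[OF mem_cones_iff[OF DiffD1[OF \<tau>]] conjunct2[OF \<tau>[unfolded Diff_iff]]])
    then show "\<rho> = \<tau>"
      by (rule covering_clique_is_facet[OF DiffD1[OF \<tau>] _ \<rho>])
  next
    show "\<rho> \<in> K" if "\<tau> \<in> K" "\<rho> \<subseteq> \<tau>" for \<rho> \<tau>
      using that unfolding mem_zero_divisor_complex_iff by blast
  qed simp
  also have "{\<tau> \<in> K - (\<Union>j\<in>{..<k}. cone_at j). card \<tau> = Suc n}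
      = {\<tau> \<in> K. (\<Union>a\<in>\<tau>. unit_support a) = {..<k} \<and> card \<tau> = Suc n}"
  proof (rule Collect_cong)
    fix \<tau>
    show "\<tau> \<in> K - (\<Union>j\<in>{..<k}. cone_at j) \<and> card \<tau> = Suc n \<longleftrightarrow>
        \<tau> \<in> K \<and> (\<Union>a\<in>\<tau>. unit_support a) = {..<k} \<and> card \<tau> = Suc n"
    proof (cases "\<tau> \<in> K")
      case True
      then show ?thesis
        unfolding Diff_iff mem_cones_iff[OF True] by blast
    qed blast
  qed
  finally show ?thesis .
qed

lemma unit_block:
  assumes x: "x \<in> (\<Pi>\<^sub>E i\<in>{..<k}. Units (R i))"
  shows "unit_block x B \<in> carrier \<Omega>"
    and "i < k \<Longrightarrow> \<pi> i (unit_block x B) = (if i \<in> B then x i else \<zero>\<^bsub>R i\<^esub>)"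
proof -
  have "(if i \<in> B then x i else \<zero>\<^bsub>R i\<^esub>) \<in> carrier (R i)" if "i < k" for i
    using that x factor_zero by (auto simp: PiE_iff Units_def)
  note tuple[OF this]
  then show "unit_block x B \<in> carrier \<Omega>"
    and "i < k \<Longrightarrow> \<pi> i (unit_block x B) = (if i \<in> B then x i else \<zero>\<^bsub>R i\<^esub>)"
    unfolding unit_block_def by blast+
qed

lemma unit_support_unit_block:
  assumes x: "x \<in> (\<Pi>\<^sub>E i\<in>{..<k}. Units (R i))" and "B \<subseteq> {..<k}"
  shows "unit_support (unit_block x B) = B"
proof -
  have "x i \<in> Units (R i)" if "i < k" for i
    using x that by (auto simp: PiE_iff)
  then show ?thesis
    using assms(2) factor_zero_nonunit by (auto simp: unit_support_def unit_block[OF x] split: if_splits)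
qed

lemma unit_block_mult:
  assumes x: "x \<in> (\<Pi>\<^sub>E i\<in>{..<k}. Units (R i))" and "B \<inter> B' = {}"
  shows "unit_block x B \<otimes> unit_block x B' = \<zero>"
proof (rule eq_zeroI)
  show "unit_block x B \<otimes> unit_block x B' \<in> carrier \<Omega>"
    using unit_block(1)[OF x] by simp
  fix i assume i: "i < k"
  interpret Ri: cring "R i" by (rule factor_cring[OF i])
  have "x i \<in> carrier (R i)"
    using x i by (auto simp: PiE_iff Units_def)
  then show "\<pi> i (unit_block x B \<otimes> unit_block x B') = \<zero>\<^bsub>R i\<^esub>"
    using assms(2) by (auto simp: proj_mult[OF i] unit_block(1)[OF x] unit_block(2)[OF x i])
qed

lemma unit_block_nonzero:
  assumes x: "x \<in> (\<Pi>\<^sub>E i\<in>{..<k}. Units (R i))" and "B \<subseteq> {..<k}" "B \<noteq> {}"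
  shows "unit_block x B \<noteq> \<zero>"
proof
  assume "unit_block x B = \<zero>"
  then have "unit_support \<zero> = B"
    using unit_support_unit_block[OF assms(1,2)] by simp
  moreover have "unit_support \<zero> = {}"
    using factor_zero_nonunit by (auto simp: unit_support_def proj_zero)
  ultimately show False using assms(3) by simp
qed

text \<open>The partition is recovered from the clique as the set of unit supports of its vertices, and the
  tuple of units by reading coordinate \<open>i\<close> off the only vertex that is a unit there. The bound on \<open>n\<close>
  provides a second block: with a single block the vertex would be a unit of \<open>\<Omega>\<close>.\<close>

lemma bij_betw_unit_blocks:
  assumes "n \<ge> 1"
  shows "bij_betw (\<lambda>(P, x). unit_block x ` P)
    ({P. partition_on {..<k} P \<and> finite P \<and> card P = Suc n} \<times> (\<Pi>\<^sub>E i\<in>{..<k}. Units (R i)))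
    {\<tau> \<in> K. (\<Union>a\<in>\<tau>. unit_support a) = {..<k} \<and> card \<tau> = Suc n}"
    (is "bij_betw ?f (?P \<times> ?U) ?T")
  unfolding bij_betw_def
proof
  have supp: "unit_support (unit_block x B) = B" if "P \<in> ?P" "x \<in> ?U" "B \<in> P" for P x B
  proof -
    have "B \<subseteq> {..<k}"
      using that(1,3) by (auto simp: partition_on_def)
    then show ?thesis
      by (rule unit_support_unit_block[OF that(2)])
  qed
  have supps: "unit_support ` unit_block x ` P = P" if "P \<in> ?P" "x \<in> ?U" for P x
    unfolding image_image using supp[OF that] by simp
  show "inj_on ?f (?P \<times> ?U)"
  proof (rule inj_onI)
    fix q q' assume q: "q \<in> ?P \<times> ?U" "q' \<in> ?P \<times> ?U" and f: "?f q = ?f q'"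
    obtain P x P' x' where eq: "q = (P, x)" "q' = (P', x')"
      by (metis surj_pair)
    have P: "P \<in> ?P" and x: "x \<in> ?U" and P': "P' \<in> ?P" and x': "x' \<in> ?U"
      using q eq by blast+
    have im: "unit_block x ` P = unit_block x' ` P'"
      using f eq by simp
    have "P = P'"
      using supps[OF P x] supps[OF P' x'] im by simp
    moreover have "x i = x' i" if i: "i \<in> {..<k}" for i
    proof -
      have "i \<in> \<Union> P"
        using P i by (auto simp: partition_on_def)
      then obtain B where B: "B \<in> P" "i \<in> B" by blast
      then have "unit_block x B \<in> unit_block x' ` P'"
        using im by blast
      then obtain B' where B': "B' \<in> P'" "unit_block x B = unit_block x' B'" by blast
      then have "B = B'"
        using supp[OF P x B(1)] supp[OF P' x' B'(1)] by simp
      then show ?thesis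
        using B' B(2) i unit_block(2)[OF x, of i B] unit_block(2)[OF x', of i B'] by simp
    qed
    then have "x = x'"
      using x x' by (intro PiE_ext)
    ultimately show "q = q'" using eq by simp
  qed
  show "?f ` (?P \<times> ?U) = ?T"
  proof
    show "?f ` (?P \<times> ?U) \<subseteq> ?T"
    proof
      fix \<tau> assume "\<tau> \<in> ?f ` (?P \<times> ?U)"
      then obtain P x where P: "P \<in> ?P" and x: "x \<in> ?U" and \<tau>: "\<tau> = unit_block x ` P"
        by auto
      have part: "disjoint P" "{} \<notin> P" "\<Union> P = {..<k}" "finite P" "card P = Suc n"
        using P by (auto simp: partition_on_def)
      have 0: "unit_block x B \<otimes> unit_block x B' = \<zero>" if "B \<in> P" "B' \<in> P" "B \<noteq> B'" for B B'
        using disjointD[OF part(1) that] by (rule unit_block_mult[OF x])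
      have nz: "unit_block x B \<noteq> \<zero>" if "B \<in> P" for B
        using that part(2,3) by (intro unit_block_nonzero[OF x]) auto
      have "unit_block x B \<in> nonzero_zero_divisors \<Omega>" if B: "B \<in> P" for B
      proof -
        have "card (P - {B}) \<noteq> 0"
          using B part(4,5) assms by simp
        then have "P - {B} \<noteq> {}"
          by (metis card.empty)
        then obtain B' where B': "B' \<in> P" "B \<noteq> B'" by blast
        show ?thesis
          using nz[OF B] nz[OF B'(1)] 0[OF B B'] unit_block(1)[OF x]
          unfolding nonzero_zero_divisors_def by blast
      qed
      then have "\<tau> \<in> K"
        using 0 unfolding \<tau> mem_zero_divisor_complex_iff by blast
      moreover have "(\<Union>a\<in>\<tau>. unit_support a) = {..<k}"
        using supps[OF P x] part(3) unfolding \<tau> by simp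
      moreover have "card \<tau> = Suc n"
      proof -
        have "inj_on (unit_block x) P"
          using supp[OF P x] by (metis inj_onI)
        then show ?thesis
          using part(5) unfolding \<tau> by (simp add: card_image)
      qed
      ultimately show "\<tau> \<in> ?T" by blast
    qed
    show "?T \<subseteq> ?f ` (?P \<times> ?U)"
    proof
      fix \<tau> assume "\<tau> \<in> ?T"
      then have \<tau>: "\<tau> \<in> K" and cover: "(\<Union>a\<in>\<tau>. unit_support a) = {..<k}" and c: "card \<tau> = Suc n"
        by blast+
      have car: "a \<in> carrier \<Omega>" "a \<noteq> \<zero>" if "a \<in> \<tau>" for a
        using clique_vertexD[OF \<tau> that] .
      have other: "\<pi> i b = \<zero>\<^bsub>R i\<^esub>" if "a \<in> \<tau>" "b \<in> \<tau>" "a \<noteq> b" "i \<in> unit_support a" for a b i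
      proof -
        have "a \<otimes> b = \<zero>"
          by (rule clique_multD[OF \<tau> that(1-3)])
        then show ?thesis
          using proj_eq_zero_of_unit[OF car(1)[OF that(1)] car(1)[OF that(2)] _ that(4)] by blast
      qed
      \<comment> \<open>Each coordinate outside the unit support of \<open>b\<close> is a unit coordinate of another vertex.\<close>
      have off: "\<pi> i b = \<zero>\<^bsub>R i\<^esub>" if b: "b \<in> \<tau>" and i: "i < k" "i \<notin> unit_support b" for b i
      proof -
        obtain a where "a \<in> \<tau>" "i \<in> unit_support a"
          using cover i(1) by blast
        then show ?thesis
          using other[of a b i] b i(2) by blast
      qed
      have disj: "unit_support a \<inter> unit_support b = {}" if "a \<in> \<tau>" "b \<in> \<tau>" "a \<noteq> b" for a b
        using other[OF that] factor_zero_nonunit by (auto simp: unit_support_def)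
      \<comment> \<open>A vertex with empty unit support would vanish in every coordinate.\<close>
      have ne: "unit_support a \<noteq> {}" if "a \<in> \<tau>" for a
        using eq_zeroI[OF car(1)[OF that]] off[OF that] car(2)[OF that] by blast
      have inj: "inj_on unit_support \<tau>"
        using disj ne by (metis inf.idem inj_onI)
      define x where "x = (\<lambda>i\<in>{..<k}. \<pi> i (THE a. a \<in> \<tau> \<and> i \<in> unit_support a))"
      have x_eq: "x i = \<pi> i a" if "a \<in> \<tau>" "i \<in> unit_support a" for a i
      proof -
        have "(THE a. a \<in> \<tau> \<and> i \<in> unit_support a) = a"
          using that disj by (intro the_equality) blast+
        then show ?thesis
          using that by (simp add: x_def unit_support_def)
      qed
      have x: "x \<in> ?U"
      proof (rule PiE_I)
        fix i assume "i \<in> {..<k}"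
        then obtain a where a: "a \<in> \<tau>" "i \<in> unit_support a"
          using cover by blast
        then show "x i \<in> Units (R i)"
          using x_eq[OF a] by (simp add: unit_support_def)
      qed (simp add: x_def)
      have block: "unit_block x (unit_support a) = a" if a: "a \<in> \<tau>" for a
      proof (rule proj_eqI)
        show "unit_block x (unit_support a) \<in> carrier \<Omega>"
          by (rule unit_block(1)[OF x])
        show "a \<in> carrier \<Omega>" by (rule car(1)[OF a])
        fix i assume i: "i < k"
        then show "\<pi> i (unit_block x (unit_support a)) = \<pi> i a"
          using unit_block(2)[OF x i] x_eq[OF a] off[OF a i] by simp
      qed
      have "finite \<tau>"
        using c by (metis card.infinite nat.distinct(1))
      moreover have "partition_on {..<k} (unit_support ` \<tau>)"
      proof (rule partition_onI)
        show "\<Union> (unit_support ` \<tau>) = {..<k}" by (rule cover)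
        show "{} \<notin> unit_support ` \<tau>" using ne by blast
        show "disjnt p q" if "p \<in> unit_support ` \<tau>" "q \<in> unit_support ` \<tau>" "p \<noteq> q" for p q
          using that disj unfolding disjnt_def by blast
      qed
      ultimately have D: "(unit_support ` \<tau>, x) \<in> ?P \<times> ?U"
        using x c card_image[OF inj] by simp
      have "?f (unit_support ` \<tau>, x) = \<tau>"
        using block by (simp add: image_image)
      from rev_image_eqI[where f = ?f, OF D this[symmetric]] show "\<tau> \<in> ?f ` (?P \<times> ?U)" .
    qed
  qed
qed

theorem reduced_betti_zero_divisor_complex:
  assumes "n \<ge> 1" "k \<ge> 1"
  shows "int (reduced_betti n K) = betti_coeff n k * (\<Prod>i<k. int (card (Units (R i))))"
proof -
  let ?P = "{P. partition_on {..<k} P \<and> finite P \<and> card P = Suc n}"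
  have "reduced_betti n K = card (?P \<times> (\<Pi>\<^sub>E i\<in>{..<k}. Units (R i)))"
    unfolding reduced_betti_eq_card_covering_cliques
    by (rule bij_betw_same_card[OF bij_betw_unit_blocks[OF assms(1)], symmetric])
  also have "\<dots> = card ?P * (\<Prod>i<k. card (Units (R i)))"
    by (simp add: card_cartesian_product card_PiE)
  moreover have "int (card ?P) = betti_coeff n k"
    using card_partitions_eq_betti_coeff[of "{..<k}" n] assms(2) by (simp add: lessThan_empty_iff)
  ultimately show ?thesis by simp
qed

end

section \<open>Products of a list of rings\<close>

lemma RDirProd_list_mult_nth:
  assumes "as \<in> carrier (RDirProd_list Rs)" "bs \<in> carrier (RDirProd_list Rs)" "i < length Rs"
  shows "(as \<otimes>\<^bsub>RDirProd_list Rs\<^esub> bs) ! i = as ! i \<otimes>\<^bsub>Rs ! i\<^esub> bs ! i"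
  using assms
proof (induction Rs arbitrary: as bs i)
  case (Cons R Rs)
  obtain a as' where as: "as = a # as'" "a \<in> carrier R" "as' \<in> carrier (RDirProd_list Rs)"
    using Cons.prems(1) unfolding RDirProd_list_carrier by auto
  obtain b bs' where bs: "bs = b # bs'" "b \<in> carrier R" "bs' \<in> carrier (RDirProd_list Rs)"
    using Cons.prems(2) unfolding RDirProd_list_carrier by auto
  let ?P = "RDirProd R (RDirProd_list Rs)"
  have "(a, as') \<otimes>\<^bsub>?P\<^esub> (b, bs') = (a \<otimes>\<^bsub>R\<^esub> b, as' \<otimes>\<^bsub>RDirProd_list Rs\<^esub> bs')"
    by (simp add: RDirProd_def DirProd_def monoid.defs)
  then have "as \<otimes>\<^bsub>RDirProd_list (R # Rs)\<^esub> bs = (a \<otimes>\<^bsub>R\<^esub> b) # (as' \<otimes>\<^bsub>RDirProd_list Rs\<^esub> bs')"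
    using ring_hom_mult[OF RDirProd_list_hom1[of R Rs], of "(a, as')" "(b, bs')"] as bs
    by (simp add: RDirProd_carrier)
  then show ?case
    using Cons.IH[OF as(3) bs(3)] Cons.prems(3) as(1) bs(1) by (cases i) simp_all
qed simp

lemma RDirProd_list_zero_nth: "i < length Rs \<Longrightarrow> \<zero>\<^bsub>RDirProd_list Rs\<^esub> ! i = \<zero>\<^bsub>Rs ! i\<^esub>"
proof (induction Rs arbitrary: i)
  case (Cons R Rs)
  then show ?case by (cases i) (simp_all add: RDirProd_list_zero')
qed simp

theorem theorem3p2:
  fixes \<Omega> :: "('a, 'm) ring_scheme" and Rs :: "('b, 'r) ring_scheme list" and k n :: nat
  assumes "cring \<Omega>" and "finite (carrier \<Omega>)"
    and "length Rs = k" and "k \<ge> 1"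
    and "\<And>i. i < k \<Longrightarrow> local_ring (Rs ! i)"
    and "\<And>i. i < k \<Longrightarrow> finite (carrier (Rs ! i))"
    and "\<Omega> \<simeq> RDirProd_list Rs"
    and "\<And>i. i < k \<Longrightarrow> \<not> field (Rs ! i)"
    and "n \<ge> 1"
  shows "int (reduced_betti n (zero_divisor_complex \<Omega>)) =
           betti_coeff n k * (\<Prod>i<k. int (card (Units (Rs ! i))))"
proof -
  let ?D = "RDirProd_list Rs"
  obtain h where "h \<in> ring_iso \<Omega> ?D"
    using assms(7) unfolding is_ring_iso_def by blast
  then have hom: "h \<in> ring_hom \<Omega> ?D" and bij: "bij_betw h (carrier \<Omega>) (carrier ?D)"
    unfolding ring_iso_def by blast+
  interpret \<Omega>: cring \<Omega> by fact
  have factor: "cring (Rs ! i)" if "i < k" for i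
    using assms(5)[OF that] unfolding local_ring_def by blast
  have "ring ?D"
    by (rule RDirProd_list_is_ring) (use factor assms(3) cring.axioms(1) in blast)
  have h_closed: "h a \<in> carrier ?D" if "a \<in> carrier \<Omega>" for a
    using bij_betwE[OF bij] that by blast
  let ?socle = "\<lambda>i t. t \<in> carrier (Rs ! i) \<and> t \<noteq> \<zero>\<^bsub>Rs ! i\<^esub> \<and> t \<notin> Units (Rs ! i) \<and>
    (\<forall>a\<in>carrier (Rs ! i). a \<notin> Units (Rs ! i) \<longrightarrow> t \<otimes>\<^bsub>Rs ! i\<^esub> a = \<zero>\<^bsub>Rs ! i\<^esub>)"
  have ex_s: "\<exists>t. ?socle i t" if i: "i < k" for i
    using local_ring_socle_element[OF assms(5)[OF i] assms(6)[OF i] assms(8)[OF i]] by metis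
  define s where "s i = (SOME t. ?socle i t)" for i
  have s: "?socle i (s i)" if "i < k" for i
    unfolding s_def using someI_ex[OF ex_s[OF that]] .
  interpret finite_ring_product \<Omega> k "\<lambda>i. Rs ! i" "\<lambda>i a. h a ! i" s
  proof (intro finite_ring_product.intro finite_ring_product_axioms.intro)
    fix i assume i: "i < k"
    then have i': "i < length Rs" using assms(3) by simp
    show "cring (Rs ! i)"
      by (rule factor[OF i])
    show "\<one>\<^bsub>Rs ! i\<^esub> \<noteq> \<zero>\<^bsub>Rs ! i\<^esub>"
      by (rule local_ring_one_not_zero[OF assms(5)[OF i]])
    show "s i \<in> carrier (Rs ! i)" "s i \<noteq> \<zero>\<^bsub>Rs ! i\<^esub>" "s i \<notin> Units (Rs ! i)"
      using s[OF i] by blast+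
    show "h \<zero>\<^bsub>\<Omega>\<^esub> ! i = \<zero>\<^bsub>Rs ! i\<^esub>"
      using ring_hom_zero[OF hom \<Omega>.ring_axioms \<open>ring ?D\<close>] RDirProd_list_zero_nth[OF i'] by simp
    fix a assume a: "a \<in> carrier \<Omega>"
    show "h a ! i \<in> carrier (Rs ! i)"
      by (rule RDirProd_list_carrier_mem(2)[OF h_closed[OF a] i'])
    fix b assume b: "b \<in> carrier \<Omega>"
    show "h (a \<otimes>\<^bsub>\<Omega>\<^esub> b) ! i = h a ! i \<otimes>\<^bsub>Rs ! i\<^esub> h b ! i"
      using ring_hom_mult[OF hom a b] RDirProd_list_mult_nth[OF h_closed[OF a] h_closed[OF b] i'] by simp
  next
    fix i x assume "i < k" "x \<in> carrier (Rs ! i)" "x \<notin> Units (Rs ! i)"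
    then show "s i \<otimes>\<^bsub>Rs ! i\<^esub> x = \<zero>\<^bsub>Rs ! i\<^esub>"
      using s by blast
  next
    fix a b assume a: "a \<in> carrier \<Omega>" and b: "b \<in> carrier \<Omega>" and eq: "\<And>i. i < k \<Longrightarrow> h a ! i = h b ! i"
    have "h a = h b"
    proof (rule nth_equalityI)
      show "length (h a) = length (h b)"
        using RDirProd_list_carrier_mem(1)[OF h_closed[OF a]] RDirProd_list_carrier_mem(1)[OF h_closed[OF b]]
        by simp
      show "h a ! i = h b ! i" if "i < length (h a)" for i
        using that eq RDirProd_list_carrier_mem(1)[OF h_closed[OF a]] assms(3) by simp
    qed
    then show "a = b"
      using bij a b by (meson bij_betw_def inj_onD)
  next
    fix f assume f: "\<And>i. i < k \<Longrightarrow> f i \<in> carrier (Rs ! i)"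
    have "map f [0..<k] \<in> carrier ?D"
      by (rule RDirProd_list_carrier_memI) (use f assms(3) in simp_all)
    then obtain a where "a \<in> carrier \<Omega>" "h a = map f [0..<k]"
      using bij by (metis bij_betw_imp_surj_on imageE)
    then show "\<exists>a\<in>carrier \<Omega>. \<forall>i<k. h a ! i = f i"
      by (intro bexI[of _ a]) simp_all
  qed (rule assms(1,2))+
  show ?thesis
    by (rule reduced_betti_zero_divisor_complex[OF assms(9) assms(4)])
qed

end
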